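(* Let $H$ be a cubic graph that is $2$-connected but not $3$-connected, and suppose $H$ is planar and bipartite. Then $K'(H,3)=1$.
   Context: Graphs are finite; multiple edges are allowed, loops are not. A proper $n$-edge coloring assigns to each edge a color from $\{1,\dots,n\}$ so that edges sharing an endpoint receive different colors. For a proper edge coloring and two distinct colors $a,b$, an edge-Kempe chain is a connected component of the subgraph formed by the edges colored $a$ or $b$; an edge-Kempe switch interchanges the colors $a$ and $b$ on one such chain, producing another proper edge coloring. Two proper $n$-edge colorings are edge-Kempe equivalent ($\sim$) if one can be obtained from the other by a finite sequence of edge-Kempe switches. $K'(G,n)$ denotes the number of edge-Kempe equivalence classes of proper $n$-edge colorings of $G$. *)

theory Defs
  imports "HOL-Analysis.Analysis"
begin

definition multigraph :: "'v set \<Rightarrow> 'e set \<Rightarrow> ('e \<Rightarrow> 'v set) \<Rightarrow> bool" where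
  "multigraph V E inc \<longleftrightarrow> finite V \<and> finite E \<and>
     (\<forall>e\<in>E. inc e \<subseteq> V \<and> card (inc e) = 2)"

definition degree :: "'e set \<Rightarrow> ('e \<Rightarrow> 'v set) \<Rightarrow> 'v \<Rightarrow> nat" where
  "degree E inc v = card {e\<in>E. v \<in> inc e}"

definition cubic :: "'v set \<Rightarrow> 'e set \<Rightarrow> ('e \<Rightarrow> 'v set) \<Rightarrow> bool" where
  "cubic V E inc \<longleftrightarrow> (\<forall>v\<in>V. degree E inc v = 3)"

inductive reach :: "'e set \<Rightarrow> ('e \<Rightarrow> 'v set) \<Rightarrow> 'v set \<Rightarrow> 'v \<Rightarrow> 'v \<Rightarrow> bool"
  for E inc S where
  refl: "u \<in> S \<Longrightarrow> reach E inc S u u"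
| step: "reach E inc S u v \<Longrightarrow> e \<in> E \<Longrightarrow> inc e \<subseteq> S \<Longrightarrow> inc e = {v, w}
          \<Longrightarrow> reach E inc S u w"

definition connected_on :: "'e set \<Rightarrow> ('e \<Rightarrow> 'v set) \<Rightarrow> 'v set \<Rightarrow> bool" where
  "connected_on E inc S \<longleftrightarrow> (\<forall>u\<in>S. \<forall>v\<in>S. reach E inc S u v)"

definition k_connected :: "nat \<Rightarrow> 'v set \<Rightarrow> 'e set \<Rightarrow> ('e \<Rightarrow> 'v set) \<Rightarrow> bool" where
  "k_connected k V E inc \<longleftrightarrow> card V > k \<and>
     (\<forall>X. X \<subseteq> V \<and> card X < k \<longrightarrow> connected_on E inc (V - X))"

definition bipartite :: "'v set \<Rightarrow> 'e set \<Rightarrow> ('e \<Rightarrow> 'v set) \<Rightarrow> bool" where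
  "bipartite V E inc \<longleftrightarrow> (\<exists>A \<subseteq> V. \<forall>e\<in>E. card (inc e \<inter> A) = 1)"

definition planar :: "'v set \<Rightarrow> 'e set \<Rightarrow> ('e \<Rightarrow> 'v set) \<Rightarrow> bool" where
  "planar V E inc \<longleftrightarrow> (\<exists>(p :: 'v \<Rightarrow> complex) (\<gamma> :: 'e \<Rightarrow> real \<Rightarrow> complex).
     inj_on p V \<and>
     (\<forall>e\<in>E. arc (\<gamma> e) \<and> {pathstart (\<gamma> e), pathfinish (\<gamma> e)} = p ` inc e \<and>
              path_image (\<gamma> e) \<inter> p ` V = p ` inc e) \<and>
     (\<forall>e\<in>E. \<forall>f\<in>E. e \<noteq> f \<longrightarrow> path_image (\<gamma> e) \<inter> path_image (\<gamma> f) \<subseteq> p ` (inc e \<inter> inc f)))"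

text \<open>Proper n-edge colourings with colours {1..n}; edges outside E get the dummy value 0
so that colourings are determined by their values on E.\<close>
definition proper_edge_col :: "'e set \<Rightarrow> ('e \<Rightarrow> 'v set) \<Rightarrow> nat \<Rightarrow> ('e \<Rightarrow> nat) \<Rightarrow> bool" where
  "proper_edge_col E inc n c \<longleftrightarrow>
     (\<forall>e\<in>E. c e \<in> {1..n}) \<and> (\<forall>e. e \<notin> E \<longrightarrow> c e = 0) \<and>
     (\<forall>e\<in>E. \<forall>f\<in>E. e \<noteq> f \<and> inc e \<inter> inc f \<noteq> {} \<longrightarrow> c e \<noteq> c f)"

definition kempe_chain :: "'e set \<Rightarrow> ('e \<Rightarrow> 'v set) \<Rightarrow> ('e \<Rightarrow> nat) \<Rightarrow> nat \<Rightarrow> nat \<Rightarrow> 'e set \<Rightarrow> bool" where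
  "kempe_chain E inc c a b C \<longleftrightarrow>
     (let Eab = {e\<in>E. c e = a \<or> c e = b};
          R = {(x, y). x \<in> Eab \<and> y \<in> Eab \<and> inc x \<inter> inc y \<noteq> {}}
      in \<exists>e\<in>Eab. C = {f. (e, f) \<in> R\<^sup>*})"

definition swap_on :: "('e \<Rightarrow> nat) \<Rightarrow> nat \<Rightarrow> nat \<Rightarrow> 'e set \<Rightarrow> 'e \<Rightarrow> nat" where
  "swap_on c a b C = (\<lambda>x. if x \<in> C then (if c x = a then b else if c x = b then a else c x) else c x)"

definition kempe_switch :: "'e set \<Rightarrow> ('e \<Rightarrow> 'v set) \<Rightarrow> nat \<Rightarrow> ('e \<Rightarrow> nat) \<Rightarrow> ('e \<Rightarrow> nat) \<Rightarrow> bool" where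
  "kempe_switch E inc n c c' \<longleftrightarrow> proper_edge_col E inc n c \<and>
     (\<exists>a b C. a \<noteq> b \<and> kempe_chain E inc c a b C \<and> c' = swap_on c a b C)"

definition kempe_equiv_rel :: "'e set \<Rightarrow> ('e \<Rightarrow> 'v set) \<Rightarrow> nat \<Rightarrow> (('e \<Rightarrow> nat) \<times> ('e \<Rightarrow> nat)) set" where
  "kempe_equiv_rel E inc n =
     {(c, c'). proper_edge_col E inc n c \<and> (kempe_switch E inc n)\<^sup>*\<^sup>* c c'}"

definition num_kempe_classes :: "'e set \<Rightarrow> ('e \<Rightarrow> 'v set) \<Rightarrow> nat \<Rightarrow> nat" where
  "num_kempe_classes E inc n =
     card ({c. proper_edge_col E inc n c} // kempe_equiv_rel E inc n)"

end

theory Submission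
  imports Defs "HOL-Complex_Analysis.Winding_Numbers"
begin

text \<open>
  Fix a drawing and a 3-edge-colouring \<open>c\<close>. The cyclic order of the colours around a vertex,
  multiplied by the bipartition sign, gives a sign at each vertex; an edge is \<^emph>\<open>bad\<close> if the signs of its
  ends differ. For colours \<open>a\<close>, \<open>b\<close> and the third colour \<open>k\<close>, the \<open>(a, b)\<close>-chains are disjoint Jordan
  curves. As colours and sides of the bipartition alternate along such a curve \<open>C\<close>, the sign at a vertex
  of \<open>C\<close> depends only on whether its \<open>k\<close>-edge lies inside \<open>C\<close>. Hence sign times \<open>(- 1) ^ n\<close>, where \<open>n\<close>
  counts the \<open>(a, b)\<close>-chains enclosing the \<open>k\<close>-edge at the vertex, is constant on each chain.
  Switching the chains on which this constant is \<open>- 1\<close> makes every \<open>k\<close>-edge good, and it does not change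
  which other edges are bad, since both their ends lie on one chain. So all bad edges can be
  removed, and a colouring without bad edges is determined by its values at one vertex.

  The sign is defined without reference to a rotation system: it is the jump, across the chain at
  the vertex, of the winding number of the chain oriented from black to white along colour \<open>a\<close>. Three
  chains through the three pairs of edges at a vertex have winding numbers whose sum is locally
  constant, which forces their jumps to agree, even if the chains come from different colourings.
\<close>

section \<open>Edge colourings of regular bipartite multigraphs\<close>

text \<open>Induction on the number of indices, after Halmos and Vaughan. A tight proper subfamily
  is matched on its own, and the other sets keep Hall's condition when its neighbours are deleted.
  If no subfamily is tight, every proper one has a neighbour to spare, so one pair can be chosen
  freely.\<close>

lemma hall:
  assumes "finite I" "\<And>i. i \<in> I \<Longrightarrow> finite (N i)" "\<And>J. J \<subseteq> I \<Longrightarrow> card J \<le> card (\<Union>(N ` J))"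
  shows "\<exists>f. inj_on f I \<and> (\<forall>i\<in>I. f i \<in> N i)"
  using assms
proof (induction "card I" arbitrary: I N rule: less_induct)
  case less
  note finI = less.prems(1) and finN = less.prems(2) and hall = less.prems(3)
  have finU: "finite (\<Union>(N ` J))" if "J \<subseteq> I" for J
    using finite_subset[OF that finI] finN that by blast
  show ?case
  proof (cases "\<exists>J. J \<subset> I \<and> J \<noteq> {} \<and> card (\<Union>(N ` J)) = card J")
    case True
    then obtain J where J: "J \<subset> I" "J \<noteq> {}" "card (\<Union>(N ` J)) = card J" by blast
    have finJ: "finite J" using J(1) finI finite_subset by blast
    have "card J < card I" using J(1) finI by (rule psubset_card_mono[rotated])
    moreover have "card K \<le> card (\<Union>(N ` K))" if "K \<subseteq> J" for K
      using hall[of K] that J(1) by blast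
    ultimately have "\<exists>f. inj_on f J \<and> (\<forall>i\<in>J. f i \<in> N i)"
      by (intro less.hyps) (use finJ finN J(1) in auto)
    then obtain f where f: "inj_on f J" "\<And>i. i \<in> J \<Longrightarrow> f i \<in> N i" by auto
    let ?N = "\<lambda>i. N i - \<Union>(N ` J)"
    have "card (I - J) < card I"
      using J finI finJ by (intro psubset_card_mono) auto
    moreover have "card K \<le> card (\<Union>(?N ` K))" if K: "K \<subseteq> I - J" for K
    proof -
      have "finite K" using K finI finite_subset by blast
      have "card K + card J = card (K \<union> J)"
        using K \<open>finite K\<close> finJ by (subst card_Un_disjoint) auto
      also have "\<dots> \<le> card (\<Union>(N ` (K \<union> J)))"
        using hall[of "K \<union> J"] K J(1) by blast
      also have "\<Union>(N ` (K \<union> J)) = \<Union>(?N ` K) \<union> \<Union>(N ` J)" by blast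
      also have "card \<dots> \<le> card (\<Union>(?N ` K)) + card (\<Union>(N ` J))" by (rule card_Un_le)
      finally show ?thesis using J(3) by simp
    qed
    ultimately have "\<exists>g. inj_on g (I - J) \<and> (\<forall>i\<in>I - J. g i \<in> ?N i)"
      by (intro less.hyps) (use finI finN in auto)
    then obtain g where g: "inj_on g (I - J)" "\<And>i. i \<in> I - J \<Longrightarrow> g i \<in> ?N i" by auto
    have "inj_on (\<lambda>i. if i \<in> J then f i else g i) I"
    proof (rule inj_onI)
      fix i j assume ij: "i \<in> I" "j \<in> I" "(if i \<in> J then f i else g i) = (if j \<in> J then f j else g j)"
      have "f k \<noteq> g l" if "k \<in> J" "l \<in> I - J" for k l
      proof -
        have "f k \<in> \<Union>(N ` J)" using f(2)[OF that(1)] that(1) by blast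
        moreover have "g l \<notin> \<Union>(N ` J)" using g(2)[OF that(2)] by blast
        ultimately show ?thesis by metis
      qed
      then show "i = j"
        using ij f(1) g(1) unfolding inj_on_def by (metis Diff_iff)
    qed
    moreover have "\<forall>i\<in>I. (if i \<in> J then f i else g i) \<in> N i"
      using f(2) g(2) by simp
    ultimately show ?thesis by blast
  next
    case no_tight: False
    show ?thesis
    proof (cases "I = {}")
      case False
      then obtain i where i: "i \<in> I" by blast
      have "card {i} \<le> card (N i)" using hall[of "{i}"] i by simp
      then have "N i \<noteq> {}" by auto
      then obtain x where x: "x \<in> N i" by blast
      let ?N = "\<lambda>j. N j - {x}"
      have "card (I - {i}) < card I" using i finI by (intro psubset_card_mono) auto
      moreover have "card K \<le> card (\<Union>(?N ` K))" if K: "K \<subseteq> I - {i}" for K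
      proof (cases "K = {}")
        case False
        have "K \<subset> I" using K i by blast
        then have "card K < card (\<Union>(N ` K))"
          using hall[of K] no_tight False by (metis le_neq_implies_less psubset_imp_subset)
        moreover have "\<Union>(?N ` K) = \<Union>(N ` K) - {x}" by blast
        ultimately show ?thesis
          by (auto simp: card_Diff_singleton_if)
      qed simp
      ultimately have "\<exists>f. inj_on f (I - {i}) \<and> (\<forall>j\<in>I - {i}. f j \<in> ?N j)"
        by (intro less.hyps) (use finI finN in auto)
      then obtain f where f: "inj_on f (I - {i})" "\<And>j. j \<in> I - {i} \<Longrightarrow> f j \<in> ?N j" by auto
      have "inj_on (f(i := x)) I"
        using f unfolding inj_on_def by (metis DiffD2 DiffI empty_iff fun_upd_apply insert_iff)
      moreover have "\<forall>j\<in>I. (f(i := x)) j \<in> N j" using f(2) x by simp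
      ultimately show ?thesis by blast
    qed simp
  qed
qed

section \<open>Perfect matchings and Koenig's edge colouring theorem\<close>

lemma card_fibres:
  assumes "finite X" "finite Y" "g ` X \<subseteq> Y" "\<And>y. y \<in> Y \<Longrightarrow> card {x \<in> X. g x = y} = k"
  shows "card X = k * card Y"
proof -
  have "card X = (\<Sum>y\<in>Y. card {x \<in> X. g x = y})"
    using sum.group[OF assms(1-3), of "\<lambda>_. 1::nat"] by simp
  also have "\<dots> = k * card Y" using assms(4) by simp
  finally show ?thesis .
qed

text \<open>Edges are points with two end maps, so parallel edges need no separate treatment. The
  \<open>k * card J\<close> edges leaving \<open>J\<close> all end in its neighbourhood, which
  receives exactly \<open>k\<close> edges per vertex; this is Hall's condition.\<close>

lemma regular_bipartite_matching:
  fixes E :: "'e set" and s :: "'e \<Rightarrow> 'a" and t :: "'e \<Rightarrow> 'b"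
  assumes E: "finite E" and k: "k > 0"
    and s: "\<And>e. e \<in> E \<Longrightarrow> card {f \<in> E. s f = s e} = k"
    and t: "\<And>e. e \<in> E \<Longrightarrow> card {f \<in> E. t f = t e} = k"
  shows "\<exists>M\<subseteq>E. bij_betw s M (s ` E) \<and> bij_betw t M (t ` E)"
proof -
  have cE: "card E = k * card (s ` E)" "card E = k * card (t ` E)"
    using s t E by (auto intro!: card_fibres)
  let ?N = "\<lambda>v. t ` {e \<in> E. s e = v}"
  have "card J \<le> card (\<Union>(?N ` J))" if J: "J \<subseteq> s ` E" for J
  proof -
    let ?X = "{e \<in> E. s e \<in> J}" and ?T = "\<Union>(?N ` J)"
    have fin: "finite J" "finite ?T" "finite ?X"
      using J E by (auto intro: finite_subset)
    have "k * card J = card ?X"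
    proof (rule card_fibres[symmetric])
      fix v assume v: "v \<in> J"
      then have "{x \<in> ?X. s x = v} = {x \<in> E. s x = v}" by blast
      then show "card {x \<in> ?X. s x = v} = k" using s J v by auto
    qed (use fin in auto)
    also have "\<dots> \<le> card {e \<in> E. t e \<in> ?T}"
      using E by (intro card_mono) auto
    also have "\<dots> = k * card ?T"
    proof (rule card_fibres)
      fix v assume v: "v \<in> ?T"
      then have "{x \<in> {e \<in> E. t e \<in> ?T}. t x = v} = {x \<in> E. t x = v}" by blast
      then show "card {x \<in> {e \<in> E. t e \<in> ?T}. t x = v} = k" using t v by auto
    qed (use fin E in auto)
    finally show ?thesis using k by simp
  qed
  then obtain h where h: "inj_on h (s ` E)" "\<And>v. v \<in> s ` E \<Longrightarrow> h v \<in> ?N v"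
    using hall[of "s ` E" ?N] E by auto
  then have "\<forall>v\<in>s ` E. \<exists>e\<in>E. s e = v \<and> t e = h v" by (auto simp: image_iff) metis
  then obtain m where m: "\<And>v. v \<in> s ` E \<Longrightarrow> m v \<in> E \<and> s (m v) = v \<and> t (m v) = h v"
    by metis
  let ?M = "m ` s ` E"
  have ME: "?M \<subseteq> E" using m by blast
  have "bij_betw s ?M (s ` E)"
    unfolding bij_betw_def using m by (auto simp: inj_on_def image_image)
  moreover have "inj_on t ?M"
  proof (rule inj_onI)
    fix x y assume xy: "x \<in> ?M" "y \<in> ?M" "t x = t y"
    then obtain v w where v: "v \<in> s ` E" "x = m v" and w: "w \<in> s ` E" "y = m w" by blast
    then have "h v = h w" using xy(3) m[OF v(1)] m[OF w(1)] by simp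
    then have "v = w" using inj_onD[OF h(1) _ v(1) w(1)] by blast
    then show "x = y" using v(2) w(2) by simp
  qed
  \<comment> \<open>Hall's theorem yields only injectivity of \<open>t\<close> on the matching. It
    covers every vertex on that side because both sides have \<open>card E\<close> divided by
    \<open>k\<close> vertices.\<close>
  moreover have "t ` ?M = t ` E"
  proof (rule card_subset_eq[OF finite_imageI[OF E] image_mono[OF ME]])
    have "card (t ` ?M) = card (s ` E)"
      using card_image[OF \<open>inj_on t ?M\<close>] bij_betw_same_card[OF \<open>bij_betw s ?M (s ` E)\<close>] by metis
    then show "card (t ` ?M) = card (t ` E)" using cE k by simp
  qed
  ultimately have "bij_betw s ?M (s ` E) \<and> bij_betw t ?M (t ` E)"
    by (simp only: bij_betw_def)
  then show ?thesis using ME by blast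
qed

text \<open>Removing a perfect matching lowers all degrees by one, and the removed edges receive the
  new colour \<open>Suc k\<close>.\<close>

lemma regular_bipartite_edge_colouring:
  fixes E :: "'e set" and s :: "'e \<Rightarrow> 'a" and t :: "'e \<Rightarrow> 'b"
  assumes "finite E" "\<And>e. e \<in> E \<Longrightarrow> card {f \<in> E. s f = s e} = k" "\<And>e. e \<in> E \<Longrightarrow> card {f \<in> E. t f = t e} = k"
  shows "\<exists>c. \<forall>e\<in>E. c e \<in> {1..k} \<and> (\<forall>f\<in>E. e \<noteq> f \<longrightarrow> s e = s f \<or> t e = t f \<longrightarrow> c e \<noteq> c f)"
  using assms
proof (induction k arbitrary: E)
  case 0
  have "E = {}"
  proof (rule ccontr)
    assume "E \<noteq> {}"
    then obtain e where "e \<in> E" by blast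
    then show False using 0(1) 0(2)[of e] by auto
  qed
  then show ?case by simp
next
  case (Suc k)
  obtain M where M: "M \<subseteq> E" "bij_betw s M (s ` E)" "bij_betw t M (t ` E)"
    using regular_bipartite_matching[OF Suc.prems(1) _ Suc.prems(2,3)] by auto
  have reg: "card {f \<in> E - M. g f = g e} = k"
    if "bij_betw g M (g ` E)" "e \<in> E" "card {f \<in> E. g f = g e} = Suc k" for e and g :: "'e \<Rightarrow> 'c"
  proof -
    have "g e \<in> g ` M" using that(1,2) by (simp add: bij_betw_def)
    then obtain d where d: "d \<in> M" "g d = g e" by auto
    have "{f \<in> E - M. g f = g e} = {f \<in> E. g f = g e} - {d}"
      using d that(1) by (auto simp: bij_betw_def inj_on_def)
    then show ?thesis
      using d subsetD[OF M(1) d(1)] that(3) Suc.prems(1) by (simp add: card_Diff_singleton_if)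
  qed
  have "\<exists>c. \<forall>e\<in>E - M. c e \<in> {1..k} \<and> (\<forall>f\<in>E - M. e \<noteq> f \<longrightarrow> s e = s f \<or> t e = t f \<longrightarrow> c e \<noteq> c f)"
    by (rule Suc.IH) (use Suc.prems reg M in auto)
  then obtain c where c: "\<And>e. e \<in> E - M \<Longrightarrow> c e \<in> {1..k}"
    "\<And>e f. e \<in> E - M \<Longrightarrow> f \<in> E - M \<Longrightarrow> e \<noteq> f \<Longrightarrow> s e = s f \<or> t e = t f \<Longrightarrow> c e \<noteq> c f"
    by blast
  define d where "d e = (if e \<in> M then Suc k else c e)" for e
  have "d e \<noteq> d f" if ef: "e \<in> E" "f \<in> E" "e \<noteq> f" "s e = s f \<or> t e = t f" for e f
  proof -
    have "\<not> (e \<in> M \<and> f \<in> M)"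
      using M(2,3) ef(3,4) by (auto simp: bij_betw_def inj_on_def)
    moreover have "c e \<noteq> Suc k" if "e \<in> E - M" for e using c(1)[OF that] by auto
    ultimately show ?thesis
      using c(2)[of e f] ef unfolding d_def by (metis DiffI)
  qed
  moreover have "d e \<in> {1..Suc k}" if "e \<in> E" for e
    using c(1)[of e] that by (cases "e \<in> M") (auto simp: d_def)
  ultimately show ?case by blast
qed

section \<open>Winding numbers of Jordan curves\<close>

text \<open>These are the properties of the winding number around a Jordan curve with image
  \<open>K\<close> that are used later; \<open>\<omega>\<close> is the value inside and records the
  orientation. The values of \<open>F\<close> on \<open>K\<close> itself are left open, so that a
  sum of winding numbers of separate arcs can replace the winding number of one closed path.\<close>

definition jordan_fun :: "complex set \<Rightarrow> (complex \<Rightarrow> complex) \<Rightarrow> complex \<Rightarrow> bool" where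
  "jordan_fun K F \<omega> \<longleftrightarrow> closed K \<and> interior K = {} \<and> (\<omega> = 1 \<or> \<omega> = - 1) \<and>
     (\<forall>z. z \<notin> K \<longrightarrow> F z = 0 \<or> F z = \<omega>) \<and>
     (\<forall>t\<in>K. \<forall>r>0. \<forall>y\<in>{0, \<omega>}. \<exists>z\<in>ball t r. z \<notin> K \<and> F z = y) \<and>
     (\<forall>S. connected S \<and> S \<inter> K = {} \<longrightarrow> F constant_on S)"

lemma jordan_fun_const: "F x = F y" if "jordan_fun K F \<omega>" "connected S" "S \<inter> K = {}" "x \<in> S" "y \<in> S"
proof -
  have "F constant_on S"
    using that(1-3) by (simp add: jordan_fun_def)
  then show ?thesis
    using that(4,5) by (auto simp: constant_on_def)
qed

text \<open>Off \<open>K\<close> the function is locally constant, so a point with the desired value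
  can be moved out of any set \<open>U\<close> without interior. In the application \<open>U\<close>
  is the whole drawing.\<close>

lemma jordan_fun_near:
  assumes J: "jordan_fun K F \<omega>" and "closed U" "interior U = {}" "t \<in> K" "r > 0" "y = 0 \<or> y = \<omega>"
  obtains z where "z \<in> ball t r" "z \<notin> U" "z \<notin> K" "F z = y"
proof -
  have "closed K" "\<exists>z\<in>ball t r. z \<notin> K \<and> F z = y"
    using assms unfolding jordan_fun_def by auto
  then obtain w where w: "w \<in> ball t r" "w \<notin> K" "F w = y" by blast
  have "open (ball t r - K)"
    using \<open>closed K\<close> by (simp add: open_Diff)
  then obtain d where d: "d > 0" "ball w d \<subseteq> ball t r - K"
    using w by (meson DiffI open_contains_ball)
  have "\<not> ball w d \<subseteq> U"
    using assms(3) d(1) by (metis ball_eq_empty empty_subsetI interior_maximal linorder_not_le open_ball subset_antisym)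
  then obtain z where z: "z \<in> ball w d" "z \<notin> U" by blast
  moreover have "F z = F w"
    by (rule jordan_fun_const[OF J, of "ball w d"]) (use d z in auto)
  ultimately show ?thesis
    using that[of z] d w by auto
qed

lemma jordan_fun_cases: "z \<notin> K \<Longrightarrow> F z = 0 \<or> F z = \<omega>" if "jordan_fun K F \<omega>"
  using that by (simp add: jordan_fun_def)

lemma jordan_fun_omega: "\<omega> = 1 \<or> \<omega> = - 1" if "jordan_fun K F \<omega>"
  using that by (simp add: jordan_fun_def)

lemma jordan_fun_Ints: "z \<notin> K \<Longrightarrow> F z \<in> \<int>" if J: "jordan_fun K F \<omega>"
  using jordan_fun_cases[OF J, of z] jordan_fun_omega[OF J] by (elim impE disjE) auto

lemma jordan_fun_closed: "closed K" if "jordan_fun K F \<omega>"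
  using that by (simp add: jordan_fun_def)

lemma jordan_fun_interior: "interior K = {}" if "jordan_fun K F \<omega>"
  using that by (simp add: jordan_fun_def)

lemma jordan_fun_cong:
  assumes "jordan_fun K F \<omega>" "\<And>z. z \<notin> K \<Longrightarrow> F z = G z"
  shows "jordan_fun K G \<omega>"
  unfolding jordan_fun_def
proof (intro conjI ballI allI impI)
  fix t r y assume "t \<in> K" "r > (0::real)" "y \<in> {0, \<omega>}"
  then have "\<exists>z\<in>ball t r. z \<notin> K \<and> F z = y"
    using assms(1) unfolding jordan_fun_def by blast
  then show "\<exists>z\<in>ball t r. z \<notin> K \<and> G z = y"
    using assms(2) by metis
next
  fix S assume S: "connected S \<and> S \<inter> K = {}"
  then have "F constant_on S" using assms(1) by (simp add: jordan_fun_def)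
  moreover have "F x = G x" if "x \<in> S" for x using S assms(2) that by blast
  ultimately show "G constant_on S" by (simp add: constant_on_def)
qed (use assms in \<open>simp_all add: jordan_fun_def\<close>)

lemma jordan_fun_minus:
  assumes "jordan_fun K F \<omega>"
  shows "jordan_fun K (\<lambda>z. - F z) (- \<omega>)"
  unfolding jordan_fun_def
proof (intro conjI ballI allI impI)
  fix t r y assume "t \<in> K" "r > (0::real)" "y \<in> {0, - \<omega>}"
  then have "\<exists>z\<in>ball t r. z \<notin> K \<and> F z = - y"
    using assms unfolding jordan_fun_def by (metis insertE insertI1 insertI2 minus_equation_iff neg_0_equal_iff_equal singletonD)
  then show "\<exists>z\<in>ball t r. z \<notin> K \<and> - F z = y"
    by force
next
  fix S assume S: "connected S \<and> S \<inter> K = {}"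
  then have "F constant_on S" using assms(1) by (simp add: jordan_fun_def)
  then show "(\<lambda>z. - F z) constant_on S" by (auto simp: constant_on_def)
qed (use assms in \<open>auto simp: jordan_fun_def\<close>)

text \<open>By the Jordan curve theorem the curve is the frontier of both its inside and its
  outside, so both values occur arbitrarily close to each of its points.\<close>

lemma jordan_fun_winding_number:
  assumes g: "simple_path g" "pathfinish g = pathstart g"
  shows "\<exists>\<omega>. jordan_fun (path_image g) (winding_number g) \<omega>"
proof -
  let ?I = "inside (path_image g)" and ?O = "outside (path_image g)"
  note J = Jordan_inside_outside[OF g]
  have p: "path g" using g by (simp add: simple_path_imp_path)
  obtain \<omega> where \<omega>: "\<omega> = 1 \<or> \<omega> = - 1" "\<And>z. z \<in> ?I \<Longrightarrow> winding_number g z = \<omega>"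
    using simple_closed_path_winding_number_inside[OF g(1)] g(2) by metis
  have O: "winding_number g z = 0" if "z \<in> ?O" for z
    using winding_number_zero_in_outside[OF p g(2) that] .
  have near: "\<exists>z\<in>ball t r. z \<in> A" if "frontier A = path_image g" "t \<in> path_image g" "r > 0" for A t r
  proof -
    have "t \<in> closure A" using that by (auto simp: frontier_def)
    then show ?thesis using that(3) by (metis closure_approachable dist_commute mem_ball)
  qed
  have "jordan_fun (path_image g) (winding_number g) \<omega>"
    unfolding jordan_fun_def
  proof (intro conjI ballI allI impI)
    show "closed (path_image g)" using p by (rule closed_path_image)
    show "interior (path_image g) = {}"
    proof (rule ccontr)
      assume "interior (path_image g) \<noteq> {}"
      then obtain t where t: "t \<in> interior (path_image g)" by blast
      then obtain r where r: "r > 0" "ball t r \<subseteq> path_image g"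
        by (meson mem_interior)
      then have "t \<in> path_image g" by (simp add: subsetD)
      then obtain z where "z \<in> ball t r" "z \<in> ?I"
        using near[of ?I t r] J r(1) by blast
      then show False using r(2) inside_no_overlap[of "path_image g"] by blast
    qed
    show "winding_number g z = 0 \<or> winding_number g z = \<omega>" if "z \<notin> path_image g" for z
      using that O \<omega>(2) inside_Un_outside[of "path_image g"] by blast
    show "\<exists>z\<in>ball t r. z \<notin> path_image g \<and> winding_number g z = y"
      if t: "t \<in> path_image g" "r > 0" "y \<in> {0, \<omega>}" for t r y
    proof (cases "y = 0")
      case True
      obtain z where "z \<in> ball t r" "z \<in> ?O" using near[of ?O t r] J t by blast
      then show ?thesis using O True outside_no_overlap[of "path_image g"] by blast
    next
      case False
      obtain z where "z \<in> ball t r" "z \<in> ?I" using near[of ?I t r] J t by blast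
      then show ?thesis using \<omega>(2) False t(3) inside_no_overlap[of "path_image g"] by blast
    qed
    show "winding_number g constant_on S" if "connected S \<and> S \<inter> path_image g = {}" for S
      using winding_number_constant[OF p g(2)] that by blast
  qed (use \<omega> in auto)
  then show ?thesis by blast
qed

section \<open>Three Jordan curves sharing branches at a point\<close>

text \<open>Integrality extends from a dense set to all of \<open>B\<close> because
  \<open>\<int>\<close> is closed, and a continuous integer-valued function on a connected set is
  constant.\<close>

lemma constant_on_integer_dense:
  fixes H :: "complex \<Rightarrow> complex"
  assumes "open B" "connected B" "continuous_on B H" "interior U = {}" "\<And>z. z \<in> B \<Longrightarrow> z \<notin> U \<Longrightarrow> H z \<in> \<int>"
  shows "H constant_on B"
proof -
  have int: "H z \<in> \<int>" if "z \<in> B" for z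
  proof (rule ccontr)
    assume n: "H z \<notin> \<int>"
    let ?W = "B \<inter> H -` (- \<int>)"
    have "open ?W"
      using continuous_open_preimage[OF assms(3,1)] by (simp add: closed_Ints open_Compl)
    moreover have "?W \<subseteq> U" using assms(5) by auto
    ultimately have "?W \<subseteq> interior U" by (rule interior_maximal[rotated])
    then show False using that n assms(4) by auto
  qed
  show ?thesis
  proof (rule continuous_discrete_range_constant[OF assms(2,3)])
    fix x assume x: "x \<in> B"
    have "1 \<le> norm (H y - H x)" if "y \<in> B" "H y \<noteq> H x" for y
    proof -
      have "H y - H x \<in> \<int>" "H y - H x \<noteq> 0" using int x that by auto
      then obtain k where k: "H y - H x = of_int k" "k \<noteq> 0"
        by (metis Ints_cases of_int_0)
      have "1 \<le> \<bar>real_of_int k\<bar>" using k(2) by linarith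
      then show ?thesis using k(1) by simp
    qed
    then show "\<exists>e>0. \<forall>y. y \<in> B \<and> H y \<noteq> H x \<longrightarrow> e \<le> norm (H y - H x)"
      by (intro exI[of _ 1]) auto
  qed
qed

text \<open>Three branches \<open>X\<close>, \<open>Y\<close>, \<open>Z\<close> leave
  \<open>p\<close>, and each curve contains two of them. The sum of the three functions extends
  continuously across \<open>p\<close>, hence equals a constant \<open>h\<close> nearby. Looking
  along \<open>Z\<close> gives \<open>2 * F1 z = 2 * h - \<omega>2 - \<omega>3\<close>, so
  \<open>2 * F1 z - \<omega>1\<close> is \<open>2 * h\<close> minus all three orientations, which is
  symmetric in the curves.\<close>

lemma three_jordan_funs:
  assumes J1: "jordan_fun K1 F1 \<omega>1" and J2: "jordan_fun K2 F2 \<omega>2" and J3: "jordan_fun K3 F3 \<omega>3"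
    and U: "closed U" "interior U = {}" "K1 \<union> K2 \<union> K3 \<subseteq> U"
    and r: "r > 0" and H: "continuous_on (ball p r) H"
      "\<And>q. q \<in> ball p r \<Longrightarrow> q \<notin> U \<Longrightarrow> F1 q + F2 q + F3 q = H q"
    and X: "connected X" "X \<subseteq> K1 \<inter> K3" "X \<inter> K2 = {}" "p \<in> closure X" "x \<in> X"
    and Y: "connected Y" "Y \<subseteq> K1 \<inter> K2" "Y \<inter> K3 = {}" "p \<in> closure Y" "y \<in> Y"
    and Z: "connected Z" "Z \<subseteq> K2 \<inter> K3" "Z \<inter> K1 = {}" "p \<in> closure Z" "z \<in> Z"
  shows "2 * F1 z - \<omega>1 = 2 * F2 x - \<omega>2" "2 * F2 x - \<omega>2 = 2 * F3 y - \<omega>3"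
proof -
  have "H q \<in> \<int>" if "q \<in> ball p r" "q \<notin> U" for q
  proof -
    have "F1 q \<in> \<int>" "F2 q \<in> \<int>" "F3 q \<in> \<int>"
      using jordan_fun_Ints[OF J1] jordan_fun_Ints[OF J2] jordan_fun_Ints[OF J3] that U(3) by blast+
    then show ?thesis using H(2)[OF that] by (metis Ints_add)
  qed
  then have "H constant_on ball p r"
    by (intro constant_on_integer_dense[OF _ _ H(1) U(2)]) auto
  then obtain h where h: "\<And>q. q \<in> ball p r \<Longrightarrow> H q = h"
    by (auto simp: constant_on_def)
  \<comment> \<open>Near a point of the third branch, the function of the loop avoiding that branch is constant,
    while the function of a loop containing it takes both values.\<close>
  have local: "2 * (h - F z) = \<omega>' + \<omega>''"
    if J: "jordan_fun K F \<omega>" "jordan_fun K' F' \<omega>'" "jordan_fun K'' F'' \<omega>''"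
      and sub: "K \<union> K' \<union> K'' \<subseteq> U"
      and sum: "\<And>q. F q + F' q + F'' q = F1 q + F2 q + F3 q"
      and Z: "connected Z" "Z \<subseteq> K' \<inter> K''" "Z \<inter> K = {}" "p \<in> closure Z" "z \<in> Z"
    for K F \<omega> K' F' \<omega>' K'' F'' \<omega>'' Z z
  proof -
    obtain t where t: "t \<in> Z" "t \<in> ball p r"
      using Z(4) r by (auto simp: closure_approachable dist_commute)
    have "open (ball p r - K)"
      using jordan_fun_closed[OF J(1)] by (simp add: open_Diff)
    moreover have "t \<in> ball p r - K" using t Z(3) by blast
    ultimately obtain d where d: "d > 0" "ball t d \<subseteq> ball p r - K"
      by (meson open_contains_ball)
    have near: "F q = F z" if "q \<in> ball t d" for q
    proof -
      have "F q = F t"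
        by (rule jordan_fun_const[OF J(1), of "ball t d"]) (use d that in auto)
      also have "F t = F z"
        by (rule jordan_fun_const[OF J(1) Z(1) Z(3) t(1) Z(5)])
      finally show ?thesis .
    qed
    have *: "h - F z - y = 0 \<or> h - F z - y = \<omega>''" if y: "y = 0 \<or> y = \<omega>'" for y
    proof -
      obtain q where q: "q \<in> ball t d" "q \<notin> U" "F' q = y"
        using jordan_fun_near[OF J(2) U(1,2) _ d(1) y] t(1) Z(2) by blast
      have "F z + y + F'' q = h"
        using sum[of q] H(2)[of q] h[of q] near q d(2) by auto
      moreover have "F'' q = 0 \<or> F'' q = \<omega>''"
        using jordan_fun_cases[OF J(3)] q(2) sub by blast
      ultimately show ?thesis by (auto simp: algebra_simps)
    qed
    \<comment> \<open>As \<open>\<omega>'\<close> is nonzero, the only possibilities are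
      \<open>D = 0\<close> with opposite orientations and \<open>D = \<omega>''\<close> with equal
      ones.\<close>
    have "2 * D = \<omega>' + \<omega>''"
      if "D - 0 = 0 \<or> D - 0 = \<omega>''" "D - \<omega>' = 0 \<or> D - \<omega>' = \<omega>''" for D
      using that jordan_fun_omega[OF J(2)] jordan_fun_omega[OF J(3)] by (elim disjE) simp_all
    then show ?thesis
      using *[of 0] *[of \<omega>'] by blast
  qed
  have "2 * (h - F1 z) = \<omega>2 + \<omega>3"
    by (rule local[OF J1 J2 J3 _ _ Z]) (use U(3) in auto)
  moreover have "2 * (h - F2 x) = \<omega>1 + \<omega>3"
    by (rule local[OF J2 J1 J3 _ _ X]) (use U(3) in auto)
  moreover have "2 * (h - F3 y) = \<omega>1 + \<omega>2"
    by (rule local[OF J3 J1 J2 _ _ Y]) (use U(3) in auto)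
  ultimately show "2 * F1 z - \<omega>1 = 2 * F2 x - \<omega>2" "2 * F2 x - \<omega>2 = 2 * F3 y - \<omega>3"
    by algebra+
qed

text \<open>The orientation is the only nonzero value taken off \<open>K\<close>. This makes the
  choice in \<open>loop_sign\<close> below well determined.\<close>

lemma jordan_fun_unique:
  assumes J: "jordan_fun K F \<omega>" "jordan_fun K F \<omega>'" and "K \<noteq> {}"
  shows "\<omega> = \<omega>'"
proof -
  obtain t where t: "t \<in> K" using \<open>K \<noteq> {}\<close> by blast
  have "\<omega> = 0 \<or> \<omega> = \<omega>" by simp
  then obtain z where z: "z \<notin> K" "F z = \<omega>"
    using jordan_fun_near[OF J(1) closed_empty interior_empty t zero_less_one] by metis
  then have "\<omega> = 0 \<or> \<omega> = \<omega>'" using jordan_fun_cases[OF J(2) z(1)] by simp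
  then show ?thesis using jordan_fun_omega[OF J(1)] by auto
qed

lemma interior_UN_closed:
  fixes f :: "'a \<Rightarrow> 'b::topological_space set"
  assumes "finite A" "\<And>x. x \<in> A \<Longrightarrow> closed (f x)" "\<And>x. x \<in> A \<Longrightarrow> interior (f x) = {}"
  shows "interior (\<Union>x\<in>A. f x) = {}"
  using assms
proof (induction A)
  case (insert x A)
  then show ?case
    using interior_closed_Un_empty_interior[of "\<Union>x\<in>A. f x" "f x"] by (simp add: Un_commute closed_UN)
qed simp

section \<open>Kempe chains in bipartite cubic graphs\<close>

lemma bij_betw_card_le_inj:
  assumes "finite B" "inj_on f A" "f ` A \<subseteq> B" "card A = card B"
  shows "bij_betw f A B"
  using assms by (metis bij_betw_def card_image card_subset_eq)

text \<open>\<open>bl\<close> and \<open>wh\<close> pick the black and the white end, so each edge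
  has a canonical direction. Stating \<open>bl_neq_wh\<close> for two edges makes the two classes
  disjoint.\<close>

locale bip_cubic =
  fixes V :: "'v set" and E :: "'e set" and inc :: "'e \<Rightarrow> 'v set"
    and bl wh :: "'e \<Rightarrow> 'v"
  assumes finite_V: "finite V" and finite_E: "finite E"
    and inc_eq: "e \<in> E \<Longrightarrow> inc e = {bl e, wh e}"
    and bl_in: "e \<in> E \<Longrightarrow> bl e \<in> V" and wh_in: "e \<in> E \<Longrightarrow> wh e \<in> V"
    and bl_neq_wh: "e \<in> E \<Longrightarrow> f \<in> E \<Longrightarrow> bl e \<noteq> wh f"
    and deg3: "v \<in> V \<Longrightarrow> card {e \<in> E. v \<in> inc e} = 3"
begin

abbreviation "col \<equiv> proper_edge_col E inc 3"
abbreviation "chain \<equiv> kempe_chain E inc"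

definition star :: "'v \<Rightarrow> 'e set" where
  "star v = {e \<in> E. v \<in> inc e}"

definition two_col :: "('e \<Rightarrow> nat) \<Rightarrow> nat \<Rightarrow> nat \<Rightarrow> 'e set" where
  "two_col c a b = {e \<in> E. c e = a \<or> c e = b}"

definition adj :: "('e \<Rightarrow> nat) \<Rightarrow> nat \<Rightarrow> nat \<Rightarrow> ('e \<times> 'e) set" where
  "adj c a b = {(x, y). x \<in> two_col c a b \<and> y \<in> two_col c a b \<and> inc x \<inter> inc y \<noteq> {}}"

text \<open>A union of \<open>(a, b)\<close>-chains, expressed as closure under adjacency.\<close>

definition saturated :: "('e \<Rightarrow> nat) \<Rightarrow> nat \<Rightarrow> nat \<Rightarrow> 'e set \<Rightarrow> bool" where
  "saturated c a b X \<longleftrightarrow> X \<subseteq> two_col c a b \<and>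
     (\<forall>e\<in>X. \<forall>f\<in>two_col c a b. inc e \<inter> inc f \<noteq> {} \<longrightarrow> f \<in> X)"

definition ed :: "('e \<Rightarrow> nat) \<Rightarrow> 'v \<Rightarrow> nat \<Rightarrow> 'e" where
  "ed c v i = (THE e. e \<in> star v \<and> c e = i)"

text \<open>All bad edges of one colour are removed together, which needs several chains of the same
  colour pair to be switched at once.\<close>

definition multi_switch :: "('e \<Rightarrow> nat) \<Rightarrow> ('e \<Rightarrow> nat) \<Rightarrow> bool" where
  "multi_switch c d \<longleftrightarrow> col c \<and> (\<exists>a\<in>{1..3}. \<exists>b\<in>{1..3}. \<exists>X. a \<noteq> b \<and> saturated c a b X \<and> d = swap_on c a b X)"

lemma star_bij: "bij_betw c (star v) {1..3}" if "col c" "v \<in> V"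
proof (rule bij_betw_card_le_inj)
  show "inj_on c (star v)"
    using that by (force simp: inj_on_def star_def proper_edge_col_def)
  show "c ` star v \<subseteq> {1..3}"
    using that by (auto simp: star_def proper_edge_col_def)
  show "card (star v) = card {1..3::nat}"
    using deg3[OF that(2)] by (simp add: star_def)
qed auto

lemma star_inj: "x \<in> star v \<Longrightarrow> y \<in> star v \<Longrightarrow> c x = c y \<Longrightarrow> x = y" if "col c" "v \<in> V"
  using star_bij[OF that] by (auto simp: bij_betw_def inj_on_def)

lemma ed_star: "ed c v i \<in> star v" and col_ed: "c (ed c v i) = i"
  if "col c" "v \<in> V" "i \<in> {1..3}"
proof -
  have "\<exists>e. e \<in> star v \<and> c e = i"
    using star_bij[OF that(1,2)] that(3) by (metis bij_betw_def imageE)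
  then have "\<exists>!e. e \<in> star v \<and> c e = i"
    using star_inj[OF that(1,2)] by auto
  from theI'[OF this] show "ed c v i \<in> star v" "c (ed c v i) = i"
    by (auto simp: ed_def)
qed

lemma ed_eq: "ed c v i = e" if "col c" "v \<in> V" "e \<in> star v" "c e = i"
  unfolding ed_def using that star_inj[OF that(1,2)] by (intro the_equality) auto

lemma col_range: "e \<in> E \<Longrightarrow> col c \<Longrightarrow> c e \<in> {1..3}"
  by (auto simp: proper_edge_col_def)

lemma star_iff: "e \<in> star v \<longleftrightarrow> e \<in> E \<and> (v = bl e \<or> v = wh e)"
  using inc_eq by (auto simp: star_def)

lemma star_E: "e \<in> star v \<Longrightarrow> e \<in> E"
  by (simp add: star_def)

lemma star_V: "e \<in> star v \<Longrightarrow> v \<in> V"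
  using bl_in wh_in by (auto simp: star_iff)

lemma adj_iff: "inc e \<inter> inc f \<noteq> {} \<longleftrightarrow> (\<exists>v\<in>V. e \<in> star v \<and> f \<in> star v)" if "e \<in> E" "f \<in> E"
  using that inc_eq bl_in wh_in by (auto simp: star_def)

lemma sym_adj: "sym ((adj c a b)\<^sup>*)"
  by (rule sym_rtrancl) (auto simp: sym_def adj_def)

lemma chain_iff: "chain c a b C \<longleftrightarrow> (\<exists>e\<in>two_col c a b. C = {f. (e, f) \<in> (adj c a b)\<^sup>*})"
  by (simp add: kempe_chain_def Let_def two_col_def adj_def)

lemma chain_eq: "C = {f. (e, f) \<in> (adj c a b)\<^sup>*}" if C: "chain c a b C" and "e \<in> C"
proof -
  obtain e0 where e0: "C = {f. (e0, f) \<in> (adj c a b)\<^sup>*}"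
    using C by (auto simp: chain_iff)
  then have "(e0, e) \<in> (adj c a b)\<^sup>*" "(e, e0) \<in> (adj c a b)\<^sup>*"
    using that(2) sym_adj[of c a b] by (auto simp: sym_def)
  then show ?thesis
    unfolding e0 by (auto intro: rtrancl_trans)
qed

lemma chain_ne: "chain c a b C \<Longrightarrow> C \<noteq> {}"
  by (auto simp: chain_iff)

lemma chain_ex: "\<exists>C. chain c a b C \<and> e \<in> C" if "e \<in> two_col c a b"
  using that by (auto simp: chain_iff)

lemma chain_subset: "C \<subseteq> two_col c a b" if C: "chain c a b C"
proof
  fix f assume "f \<in> C"
  then obtain e where "(e, f) \<in> (adj c a b)\<^sup>*" "e \<in> two_col c a b"
    using C by (auto simp: chain_iff)
  then show "f \<in> two_col c a b"
    by (induction rule: rtrancl_induct) (auto simp: adj_def)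
qed

lemma chain_saturated: "saturated c a b C" if "chain c a b C"
  unfolding saturated_def
proof (intro conjI ballI impI)
  show sub: "C \<subseteq> two_col c a b"
    by (rule chain_subset[OF that])
  fix e f assume "e \<in> C" "f \<in> two_col c a b" "inc e \<inter> inc f \<noteq> {}"
  then show "f \<in> C"
    using chain_eq[OF that \<open>e \<in> C\<close>] sub by (auto simp: adj_def)
qed

lemma chain_sub_saturated: "C \<subseteq> X" if "chain c a b C" "saturated c a b X" "e \<in> C" "e \<in> X"
proof
  fix f assume "f \<in> C"
  then have "(e, f) \<in> (adj c a b)\<^sup>*"
    using chain_eq[OF that(1,3)] by auto
  then show "f \<in> X"
    using that(2,4) by (induction rule: rtrancl_induct) (auto simp: adj_def saturated_def)
qed

lemma chain_unique: "C = D" if "chain c a b C" "chain c a b D" "e \<in> C" "e \<in> D"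
  using chain_eq that by metis

lemma finite_chains: "finite {C. chain c a b C}"
proof (rule finite_subset)
  show "{C. chain c a b C} \<subseteq> Pow E"
    using chain_subset by (fastforce simp: two_col_def)
qed (use finite_E in auto)

section \<open>Switching several chains at once\<close>

lemma swap_same: "two_col (swap_on c a b X) a b = two_col c a b"
  by (auto simp: two_col_def swap_on_def split: if_splits)

lemma saturated_swap: "saturated (swap_on c a b X) a b Y = saturated c a b Y"
  by (simp add: saturated_def swap_same)

lemma swap_swap: "swap_on (swap_on c a b X) a b X = c"
  by (auto simp: swap_on_def)

lemma saturated_col: "col (swap_on c a b X)"
  if "col c" "saturated c a b X" "a \<in> {1..3}" "b \<in> {1..3}" "a \<noteq> b"
proof -
  have X: "X \<subseteq> E" "\<And>e. e \<in> X \<Longrightarrow> c e = a \<or> c e = b"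
    using that(2) by (auto simp: saturated_def two_col_def)
  have "swap_on c a b X e \<noteq> swap_on c a b X f"
    if "e \<in> E" "f \<in> E" "e \<noteq> f" "inc e \<inter> inc f \<noteq> {}" for e f
  proof -
    have ne: "c e \<noteq> c f"
      using that \<open>col c\<close> by (auto simp: proper_edge_col_def)
    have "e \<in> X \<Longrightarrow> c f = a \<or> c f = b \<Longrightarrow> f \<in> X" "f \<in> X \<Longrightarrow> c e = a \<or> c e = b \<Longrightarrow> e \<in> X"
      using that \<open>saturated c a b X\<close> unfolding saturated_def two_col_def by blast+
    then show ?thesis
      using ne X(2)[of e] X(2)[of f] by (auto simp: swap_on_def)
  qed
  moreover have "swap_on c a b X e = 0" if "e \<notin> E" for e
    using that X \<open>col c\<close> by (auto simp: swap_on_def proper_edge_col_def)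
  moreover have "swap_on c a b X e \<in> {1..3}" if "e \<in> E" for e
    using col_range[OF that \<open>col c\<close>] \<open>a \<in> {1..3}\<close> \<open>b \<in> {1..3}\<close> by (auto simp: swap_on_def)
  ultimately show ?thesis
    by (auto simp: proper_edge_col_def)
qed

text \<open>Chains are peeled off one at a time. A switch of \<open>a\<close> and \<open>b\<close>
  does not change which edges have one of these colours, so the rest of \<open>X\<close> stays
  saturated for the new colouring.\<close>

lemma saturated_switches: "(kempe_switch E inc 3)\<^sup>*\<^sup>* c (swap_on c a b X)"
  if "col c" "saturated c a b X" "a \<in> {1..3}" "b \<in> {1..3}" "a \<noteq> b"
proof -
  have "finite X"
    using that(2) finite_E by (auto simp: saturated_def two_col_def intro: finite_subset)
  then show ?thesis
    using that
  proof (induction X arbitrary: c rule: finite_psubset_induct)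
    case (psubset X)
    show ?case
    proof (cases "X = {}")
      case True
      then show ?thesis by (simp add: swap_on_def)
    next
      case False
      then obtain e where e: "e \<in> X" by blast
      then obtain C where C: "chain c a b C" "e \<in> C"
        using chain_ex psubset.prems(2) unfolding saturated_def by blast
      let ?d = "swap_on c a b C"
      have CX: "C \<subseteq> X"
        by (rule chain_sub_saturated[OF C(1) psubset.prems(2) C(2) e])
      have d: "col ?d"
        by (rule saturated_col[OF psubset.prems(1) chain_saturated[OF C(1)] psubset.prems(3-)])
      have step: "kempe_switch E inc 3 c ?d"
        using psubset.prems C(1) by (auto simp: kempe_switch_def)
      have "saturated c a b (X - C)"
        using psubset.prems(2) chain_saturated[OF C(1)] unfolding saturated_def
        by (metis Diff_iff Int_commute in_mono subsetI)
      then have "saturated ?d a b (X - C)"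
        by (simp add: saturated_swap)
      moreover have "X - C \<subset> X"
        using CX C(2) by blast
      ultimately have "(kempe_switch E inc 3)\<^sup>*\<^sup>* ?d (swap_on ?d a b (X - C))"
        using psubset.IH d psubset.prems(3-) by blast
      moreover have "swap_on ?d a b (X - C) = swap_on c a b X"
        using CX by (auto simp: swap_on_def fun_eq_iff)
      ultimately show ?thesis
        using step by (metis converse_rtranclp_into_rtranclp)
    qed
  qed
qed

lemma multi_switchI: "\<lbrakk>col c; saturated c a b X; a \<in> {1..3}; b \<in> {1..3}; a \<noteq> b\<rbrakk> \<Longrightarrow> multi_switch c (swap_on c a b X)"
  unfolding multi_switch_def by blast

lemma multi_switch_col: "multi_switch c d \<Longrightarrow> col d"
  unfolding multi_switch_def using saturated_col by blast

lemma multi_switches_col: "multi_switch\<^sup>*\<^sup>* c d \<Longrightarrow> col c \<Longrightarrow> col d"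
  by (induction rule: rtranclp_induct) (auto intro: multi_switch_col)

lemma multi_switch_sym: "multi_switch c d \<Longrightarrow> multi_switch d c"
  by (smt (verit, best) multi_switch_def multi_switch_col saturated_swap swap_swap)

lemma multi_switches_sym: "multi_switch\<^sup>*\<^sup>* c d \<Longrightarrow> multi_switch\<^sup>*\<^sup>* d c"
  by (metis multi_switch_sym symp_rtranclp sympD sympI)

lemma multi_switches_kempe: "(kempe_switch E inc 3)\<^sup>*\<^sup>* c d" if "multi_switch\<^sup>*\<^sup>* c d"
  using that
proof (induction rule: rtranclp_induct)
  case (step d f)
  then have "(kempe_switch E inc 3)\<^sup>*\<^sup>* d f"
    by (auto simp: multi_switch_def intro: saturated_switches)
  with step show ?case by simp
qed simp

lemma saturated_star: "x \<in> X \<longleftrightarrow> y \<in> X"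
  if "saturated c a b X" "x \<in> star v" "y \<in> star v" "x \<in> two_col c a b" "y \<in> two_col c a b"
  using that unfolding saturated_def star_def by blast

text \<open>Koenig's theorem for \<open>k = 3\<close>; adjacent edges share their black or their
  white end. Without any colouring the number of classes would be 0.\<close>

lemma colouring_exists: "\<exists>c. col c"
proof -
  have fib: "card {f \<in> E. bl f = bl e} = 3" "card {f \<in> E. wh f = wh e} = 3" if e: "e \<in> E" for e
  proof -
    have "{f \<in> E. bl f = bl e} = {f \<in> E. bl e \<in> inc f}" "{f \<in> E. wh f = wh e} = {f \<in> E. wh e \<in> inc f}"
      using inc_eq bl_neq_wh e by force+
    then show "card {f \<in> E. bl f = bl e} = 3" "card {f \<in> E. wh f = wh e} = 3"
      using deg3[OF bl_in[OF e]] deg3[OF wh_in[OF e]] by simp_all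
  qed
  obtain c where c: "\<And>e. e \<in> E \<Longrightarrow> c e \<in> {1..3::nat}"
    "\<And>e f. e \<in> E \<Longrightarrow> f \<in> E \<Longrightarrow> e \<noteq> f \<Longrightarrow> bl e = bl f \<or> wh e = wh f \<Longrightarrow> c e \<noteq> c f"
    using regular_bipartite_edge_colouring[OF finite_E fib] by metis
  have "col (\<lambda>e. if e \<in> E then c e else 0)"
    unfolding proper_edge_col_def
  proof (intro conjI ballI allI impI)
    fix e f assume ef: "e \<in> E" "f \<in> E" "e \<noteq> f \<and> inc e \<inter> inc f \<noteq> {}"
    have "bl e \<noteq> wh f" "bl f \<noteq> wh e" using bl_neq_wh ef by auto
    then have "bl e = bl f \<or> wh e = wh f"
      using ef inc_eq by auto
    then show "(if e \<in> E then c e else 0) \<noteq> (if f \<in> E then c f else 0)"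
      using c(2)[of e f] ef by simp
  qed (use c(1) in auto)
  then show ?thesis by blast
qed

end

lemma num_kempe_classes_eq_1:
  assumes "proper_edge_col E inc n c"
    and "\<And>c d. proper_edge_col E inc n c \<Longrightarrow> proper_edge_col E inc n d \<Longrightarrow> (kempe_switch E inc n)\<^sup>*\<^sup>* c d"
  shows "num_kempe_classes E inc n = 1"
proof -
  let ?R = "kempe_equiv_rel E inc n"
  have "?R `` {d} = ?R `` {c}" if "proper_edge_col E inc n d" for d
    using assms(2)[OF that assms(1)] assms(2)[OF assms(1) that] that assms(1)
    by (auto simp: kempe_equiv_rel_def intro: rtranclp_trans)
  then have "{c. proper_edge_col E inc n c} // ?R = {?R `` {c}}"
    using assms(1) unfolding quotient_def by blast
  then show ?thesis
    by (simp add: num_kempe_classes_def)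
qed

section \<open>Removing bad edges\<close>

text \<open>The sign of the cyclic order of two distinct colours: 1 exactly when \<open>b\<close>
  follows \<open>a\<close> in the cycle 1, 2, 3.\<close>

definition eps :: "nat \<Rightarrow> nat \<Rightarrow> complex" where
  "eps a b = (if (a, b) \<in> {(1, 2), (2, 3), (3, 1)} then 1 else - 1)"

lemma three_cases:
  assumes "p \<in> {1..3::nat}" "q \<in> {1..3}" "r \<in> {1..3}" "s \<in> {1..3}"
    and "p \<noteq> q" "p \<noteq> r" "q \<noteq> r" "s \<noteq> p" "s \<noteq> r"
  shows "s = q"
proof -
  have "p = 1 \<or> p = 2 \<or> p = 3" "q = 1 \<or> q = 2 \<or> q = 3" "r = 1 \<or> r = 2 \<or> r = 3" "s = 1 \<or> s = 2 \<or> s = 3"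
    using assms(1-4) by auto
  then show ?thesis
    using assms(5-) by metis
qed

text \<open>\<open>S c a b v\<close> is the sign of \<open>v\<close> read off the \<open>(a, b)\<close>-chain through \<open>v\<close>; \<open>S_cyc\<close> says that it is an
  orientation of the three edges at \<open>v\<close> that does not depend on the colouring, and \<open>t\<close> in \<open>S_bal\<close> is
  the parity of the number of chains enclosing an edge.\<close>
locale kempe_sign = bip_cubic V E inc bl wh
  for V :: "'v set" and E :: "'e set" and inc :: "'e \<Rightarrow> 'v set" and bl wh :: "'e \<Rightarrow> 'v" +
  fixes S :: "('e \<Rightarrow> nat) \<Rightarrow> nat \<Rightarrow> nat \<Rightarrow> 'v \<Rightarrow> complex"
  assumes S_pm: "\<lbrakk>col c; v \<in> V; a \<in> {1..3}; b \<in> {1..3}; a \<noteq> b\<rbrakk> \<Longrightarrow> S c a b v = 1 \<or> S c a b v = - 1"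
    and S_anti: "\<lbrakk>col c; v \<in> V; a \<in> {1..3}; b \<in> {1..3}; a \<noteq> b\<rbrakk> \<Longrightarrow> S c b a v = - S c a b v"
    and S_cyc: "\<lbrakk>col c; col d; x \<in> star v; y \<in> star v; z \<in> star v; x \<noteq> y; y \<noteq> z; x \<noteq> z\<rbrakk>
      \<Longrightarrow> S c (c x) (c y) v = S d (d y) (d z) v"
    and S_bal: "\<lbrakk>col c; a \<in> {1..3}; b \<in> {1..3}; k \<in> {1..3}; a \<noteq> b; a \<noteq> k; b \<noteq> k\<rbrakk>
      \<Longrightarrow> \<exists>t. (\<forall>e. t e = 1 \<or> t e = - 1) \<and> (\<forall>C. chain c a b C \<longrightarrow>
            (\<exists>\<kappa>. \<forall>e\<in>C. \<forall>v\<in>inc e. S c a b v = \<kappa> * t (ed c v k)))"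
    and conn: "connected_on E inc V"
begin

text \<open>The colours 1 and 2 are an arbitrary choice: by \<open>S_eps\<close> any two distinct
  colours give the same set, see \<open>bad_iff\<close>.\<close>

definition bad :: "('e \<Rightarrow> nat) \<Rightarrow> 'e set" where
  "bad c = {e \<in> E. S c 1 2 (bl e) \<noteq> S c 1 2 (wh e)}"

lemma third_edge: "\<exists>z\<in>star v. z \<noteq> x \<and> z \<noteq> y" if "v \<in> V"
proof (rule ccontr)
  assume "\<not> ?thesis"
  then have "star v \<subseteq> {x, y}" by auto
  then have "card (star v) \<le> card {x, y}" by (intro card_mono) auto
  also have "\<dots> \<le> 2" by (simp add: card_insert_if)
  finally show False using deg3[OF that] by (simp add: star_def)
qed

text \<open>Each use of \<open>S_cyc\<close> turns the pair of edges one step around the vertex.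
  After three steps the pair is back in place, and the last step also changes the colouring. So an
  ordered pair of edges at \<open>v\<close> has a sign independent of the colouring.\<close>

lemma S_mix: "S c (c x) (c y) v = S d (d x) (d y) v"
  if "col c" "col d" "x \<in> star v" "y \<in> star v" "x \<noteq> y"
proof -
  obtain z where z: "z \<in> star v" "z \<noteq> x" "z \<noteq> y"
    using third_edge[OF star_V[OF \<open>x \<in> star v\<close>]] by metis
  have "S c (c x) (c y) v = S c (c y) (c z) v"
    by (rule S_cyc) (use that z in auto)
  also have "\<dots> = S c (c z) (c x) v"
    by (rule S_cyc) (use that z in auto)
  also have "\<dots> = S d (d x) (d y) v"
    by (rule S_cyc) (use that z in auto)
  finally show ?thesis .
qed

lemma S_col3: "S c 2 3 v = S c 1 2 v" "S c 3 1 v = S c 1 2 v" if "col c" "v \<in> V"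
proof -
  have e: "ed c v i \<in> star v" "c (ed c v i) = i" if "i \<in> {1..3}" for i
    using ed_star col_ed \<open>col c\<close> \<open>v \<in> V\<close> that by auto
  have ne: "ed c v i \<noteq> ed c v j" if "i \<in> {1..3}" "j \<in> {1..3}" "i \<noteq> j" for i j
    using e that by metis
  show 1: "S c 2 3 v = S c 1 2 v"
    using S_cyc[OF \<open>col c\<close> \<open>col c\<close>, of "ed c v 1" v "ed c v 2" "ed c v 3"] e ne by simp
  show "S c 3 1 v = S c 1 2 v"
    using S_cyc[OF \<open>col c\<close> \<open>col c\<close>, of "ed c v 2" v "ed c v 3" "ed c v 1"] e ne 1 by simp
qed

lemma S_eps: "S c a b v = eps a b * S c 1 2 v"
  if "col c" "v \<in> V" "a \<in> {1..3}" "b \<in> {1..3}" "a \<noteq> b"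
proof -
  have "(a = 1 \<or> a = 2 \<or> a = 3) \<and> (b = 1 \<or> b = 2 \<or> b = 3)"
    using that by auto
  then show ?thesis
    using S_col3[OF that(1,2)] S_anti[OF that(1,2), of 1 2] S_anti[OF that(1,2), of 2 3]
      S_anti[OF that(1,2), of 3 1] \<open>a \<noteq> b\<close>
    by (elim conjE disjE) (auto simp: eps_def)
qed

lemma S_eq_iff: "S c a b v = S d a b w \<longleftrightarrow> S c 1 2 v = S d 1 2 w"
  if "col c" "col d" "v \<in> V" "w \<in> V" "a \<in> {1..3}" "b \<in> {1..3}" "a \<noteq> b"
proof -
  have "eps a b \<noteq> 0"
    by (simp add: eps_def)
  then show ?thesis
    using S_eps[OF that(1,3,5-)] S_eps[OF that(2,4,5-)] by simp
qed

lemma bad_iff: "e \<in> bad c \<longleftrightarrow> S c a b (bl e) \<noteq> S c a b (wh e)"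
  if "col c" "e \<in> E" "a \<in> {1..3}" "b \<in> {1..3}" "a \<noteq> b"
  using S_eq_iff[OF that(1,1) bl_in[OF that(2)] wh_in[OF that(2)] that(3-)] that(2) by (auto simp: bad_def)

text \<open>The sign of an ordered pair of edges is the same for both colourings, so exchanging the
  colours of the two edges amounts to exchanging the colour arguments of \<open>S\<close>.\<close>

lemma S_swap:
  assumes "col c" "v \<in> V" "a \<in> {1..3}" "b \<in> {1..3}" "a \<noteq> b" "saturated c a b X"
  shows "S (swap_on c a b X) a b v = (if ed c v a \<in> X then - S c a b v else S c a b v)"
proof -
  let ?d = "swap_on c a b X" and ?x = "ed c v a" and ?y = "ed c v b"
  have d: "col ?d" by (rule saturated_col) (use assms in auto)
  have st: "?x \<in> star v" "?y \<in> star v" "c ?x = a" "c ?y = b"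
    using assms by (auto simp: ed_star col_ed)
  have ne: "?x \<noteq> ?y" using st assms by metis
  have iff: "?x \<in> X \<longleftrightarrow> ?y \<in> X"
    using saturated_star[OF assms(6) st(1,2)] st by (simp add: two_col_def star_def)
  have mix: "S c a b v = S ?d (?d ?x) (?d ?y) v"
    using S_mix[OF assms(1) d st(1,2) ne] st by simp
  show ?thesis
  proof (cases "?x \<in> X")
    case True
    then have "?d ?x = b" "?d ?y = a"
      using st(3,4) iff assms(5) by (simp_all add: swap_on_def)
    then have "S c a b v = S ?d b a v"
      using mix by metis
    then show ?thesis
      using S_anti[OF d assms(2-5)] True by simp
  next
    case False
    then have "?d ?x = a" "?d ?y = b"
      using st(3,4) iff by (simp_all add: swap_on_def)
    then show ?thesis
      using mix False by metis
  qed
qed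

text \<open>The switch is chosen so that the new sign at \<open>v\<close> is
  \<open>t (ed c v k)\<close>, which is read off the \<open>k\<close>-edge and hence agrees at its
  two ends. An edge of colour \<open>a\<close> or \<open>b\<close> lies on one chain, so both its
  ends change sign or neither does.\<close>

lemma reduce_bad:
  assumes "col c" "a \<in> {1..3}" "b \<in> {1..3}" "k \<in> {1..3}" "a \<noteq> b" "a \<noteq> k" "b \<noteq> k"
  shows "\<exists>d. multi_switch c d \<and> bad d = bad c - {e. c e = k}"
proof -
  obtain t where t: "\<And>e. t e = 1 \<or> t e = - 1"
    and tC: "\<And>C. chain c a b C \<Longrightarrow> \<exists>\<kappa>. \<forall>e\<in>C. \<forall>v\<in>inc e. S c a b v = \<kappa> * t (ed c v k)"
    using S_bal[OF assms] by metis
  \<comment> \<open>The union of the chains on which the factor \<open>\<kappa>\<close> from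
    \<open>S_bal\<close> is \<open>- 1\<close>.\<close>
  define X where "X = {e \<in> two_col c a b. \<exists>v\<in>inc e. S c a b v \<noteq> t (ed c v k)}"
  have X: "S c a b v \<noteq> t (ed c v k) \<longleftrightarrow> S c a b w \<noteq> t (ed c w k)"
    if "chain c a b C" "e \<in> C" "f \<in> C" "v \<in> inc e" "w \<in> inc f" for C e f v w
  proof -
    from tC[OF that(1)] that
    obtain \<kappa> where \<kappa>: "S c a b v = \<kappa> * t (ed c v k)" "S c a b w = \<kappa> * t (ed c w k)"
      by metis
    show ?thesis
      using \<kappa> t[of "ed c v k"] t[of "ed c w k"] by (metis mult_cancel_right1 zero_neq_neg_one zero_neq_one)
  qed
  have sat: "saturated c a b X"
    unfolding saturated_def
  proof (intro conjI ballI impI)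
    fix e f assume *: "e \<in> X" "f \<in> two_col c a b" "inc e \<inter> inc f \<noteq> {}"
    then have "e \<in> two_col c a b" by (simp add: X_def)
    then obtain C where C: "chain c a b C" "e \<in> C"
      using chain_ex by blast
    then have "f \<in> C"
      using chain_saturated[OF C(1)] * by (auto simp: saturated_def)
    moreover obtain v where "v \<in> inc e" "S c a b v \<noteq> t (ed c v k)"
      using *(1) by (auto simp: X_def)
    moreover obtain w where "w \<in> inc f"
      using *(3) by auto
    ultimately show "f \<in> X"
      using X[OF C] *(2) by (auto simp: X_def)
  qed (auto simp: X_def)
  have touch: "e \<in> X \<longleftrightarrow> S c a b v \<noteq> t (ed c v k)" if e: "e \<in> two_col c a b" "v \<in> inc e" for e v
  proof -
    obtain C where C: "chain c a b C" "e \<in> C"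
      using chain_ex e by blast
    have "S c a b v \<noteq> t (ed c v k) \<longleftrightarrow> S c a b w \<noteq> t (ed c w k)" if "w \<in> inc e" for w
      by (rule X[OF C C(2) e(2) that])
    then show ?thesis
      unfolding X_def using e by blast
  qed
  let ?d = "swap_on c a b X"
  have d: "col ?d"
    using saturated_col[OF assms(1) sat assms(2,3,5)] .
  have ed2: "ed c v a \<in> two_col c a b" "v \<in> inc (ed c v a)" if "v \<in> V" for v
    using ed_star[OF assms(1) that assms(2)] col_ed[OF assms(1) that assms(2)]
    by (simp_all add: two_col_def star_def)
  have Sd: "S ?d a b v = t (ed c v k)" if "v \<in> V" for v
  proof (cases "S c a b v = t (ed c v k)")
    case True
    then show ?thesis
      using S_swap[OF assms(1) that assms(2,3,5) sat] touch[OF ed2[OF that]] by simp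
  next
    case False
    then have "S c a b v = - t (ed c v k)"
      using S_pm[OF assms(1) that assms(2,3,5)] t[of "ed c v k"] by (elim disjE) simp_all
    then show ?thesis
      using S_swap[OF assms(1) that assms(2,3,5) sat] touch[OF ed2[OF that]] False by simp
  qed
  have "e \<in> bad ?d \<longleftrightarrow> e \<in> bad c \<and> c e \<noteq> k" if e: "e \<in> E" for e
  proof (cases "c e = k")
    case True
    have "ed c (bl e) k = e" "ed c (wh e) k = e"
      using ed_eq[OF assms(1)] bl_in wh_in e True by (auto simp: star_iff)
    then show ?thesis
      using bad_iff[OF d e assms(2,3,5)] Sd bl_in wh_in e True by simp
  next
    case False
    then have "c e = a \<or> c e = b"
      using three_cases[OF assms(4,3,2) col_range[OF e assms(1)]] assms(5-7) by metis
    then have e2: "e \<in> two_col c a b"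
      using e by (simp add: two_col_def)
    have "ed c v a \<in> X \<longleftrightarrow> e \<in> X" if v: "v \<in> inc e" for v
    proof -
      have "v \<in> V" using inc_eq[OF e] v bl_in[OF e] wh_in[OF e] by auto
      then show ?thesis using touch[OF e2 v] touch[OF ed2] by blast
    qed
    then have "ed c (bl e) a \<in> X \<longleftrightarrow> ed c (wh e) a \<in> X"
      using inc_eq[OF e] by auto
    then show ?thesis
      using bad_iff[OF d e assms(2,3,5)] bad_iff[OF assms(1) e assms(2,3,5)] False
        S_swap[OF assms(1) bl_in[OF e] assms(2,3,5) sat]
        S_swap[OF assms(1) wh_in[OF e] assms(2,3,5) sat] by simp
  qed
  then have "bad ?d = bad c - {e. c e = k}"
    by (auto simp: bad_def)
  moreover have "multi_switch c ?d"
    by (rule multi_switchI) (use assms sat in auto)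
  ultimately show ?thesis by blast
qed

text \<open>Each round takes some bad edge and removes all bad edges of its colour while creating
  none, so their number decreases.\<close>

lemma reach_good: "\<exists>d. multi_switch\<^sup>*\<^sup>* c d \<and> bad d = {}" if "col c"
  using that
proof (induction "card (bad c)" arbitrary: c rule: less_induct)
  case less
  show ?case
  proof (cases "bad c = {}")
    case False
    then obtain e where e: "e \<in> bad c" by blast
    then have k: "c e \<in> {1..3}"
      using less.prems col_range by (auto simp: bad_def)
    \<comment> \<open>The witnesses are the two colours other than \<open>c e\<close>, in increasing
      order.\<close>
    then have "\<exists>a b. a \<in> {1..3} \<and> b \<in> {1..3} \<and> a \<noteq> b \<and> a \<noteq> c e \<and> b \<noteq> c e"
      by (intro exI[of _ "if c e = 1 then 2 else 1"] exI[of _ "if c e = 3 then 2 else 3"]) auto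
    then obtain d where d: "multi_switch c d" "bad d = bad c - {f. c f = c e}"
      using reduce_bad[OF less.prems] k by metis
    have "finite (bad c)"
      using finite_E by (simp add: bad_def)
    then have "card (bad d) < card (bad c)"
      using d(2) e by (intro psubset_card_mono) auto
    then show ?thesis
      using less.hyps[of d] multi_switch_col[OF d(1)] d(1) converse_rtranclp_into_rtranclp[of multi_switch c d]
      by blast
  qed auto
qed

section \<open>Colourings without bad edges\<close>

text \<open>Exchanging two colours everywhere reverses the sign of every vertex, so no edge becomes
  bad. These swaps serve to rename colours.\<close>

lemma full_swap:
  assumes "col c" "bad c = {}" "a \<in> {1..3}" "b \<in> {1..3}" "a \<noteq> b"
  defines "d \<equiv> swap_on c a b (two_col c a b)"
  shows "multi_switch c d" "bad d = {}" "col d"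
    "e \<in> E \<Longrightarrow> d e = (if c e = a then b else if c e = b then a else c e)"
proof -
  have sat: "saturated c a b (two_col c a b)"
    by (auto simp: saturated_def)
  show ms: "multi_switch c d"
    unfolding d_def by (rule multi_switchI) (use assms sat in auto)
  show d: "col d" by (rule multi_switch_col[OF ms])
  have "S d a b v = - S c a b v" if "v \<in> V" for v
    using S_swap[OF assms(1) that assms(3-5) sat] ed_star[OF assms(1) that assms(3)]
      col_ed[OF assms(1) that assms(3)] by (simp add: d_def two_col_def star_def)
  then have "e \<in> bad d \<longleftrightarrow> e \<in> bad c" if "e \<in> E" for e
    using bad_iff[OF d that assms(3-5)] bad_iff[OF assms(1) that assms(3-5)] bl_in wh_in that by auto
  then show "bad d = {}"
    using assms(2) by (auto simp: bad_def)
  show "e \<in> E \<Longrightarrow> d e = (if c e = a then b else if c e = b then a else c e)"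
    by (auto simp: d_def swap_on_def two_col_def)
qed

text \<open>If the colourings differed at \<open>w\<close>, they would differ by exchanging the
  colours of the two edges other than \<open>e\<close>, and this reverses the sign.\<close>

lemma agree_propagates:
  assumes "col c" "col d" "w \<in> V" "e \<in> star w" "c e = d e" "S c 1 2 w = S d 1 2 w" "x \<in> star w"
  shows "c x = d x"
proof (rule ccontr)
  assume ne: "c x \<noteq> d x"
  then have xe: "x \<noteq> e" using assms by auto
  obtain y where y: "y \<in> star w" "y \<noteq> x" "y \<noteq> e"
    using third_edge[OF assms(3)] by metis
  have dist: "f x \<noteq> f y" "f x \<noteq> f e" "f y \<noteq> f e" "f x \<in> {1..3}" "f y \<in> {1..3}" "f e \<in> {1..3}"
    if "col f" for f
    using star_inj[OF that assms(3,7) y(1)] star_inj[OF that assms(3,7,4)] star_inj[OF that assms(3) y(1) assms(4)]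
      y(2,3) xe col_range[OF star_E[OF assms(7)] that] col_range[OF star_E[OF y(1)] that]
      col_range[OF star_E[OF assms(4)] that] by auto
  have sw: "d x = c y" "d y = c x"
    using three_cases[of "c x" "c y" "c e" "d x"] three_cases[of "c y" "c x" "c e" "d y"]
      dist[OF assms(1)] dist[OF assms(2)] ne assms(5) by metis+
  note cxy = dist(4,5,1)[OF assms(1)]
  have "S c (c x) (c y) w = S d (c y) (c x) w"
    using S_mix[OF assms(1,2,7) y(1)] y(2) sw by simp
  also have "\<dots> = - S d (c x) (c y) w"
    by (rule S_anti[OF assms(2,3) cxy])
  also have "S d (c x) (c y) w = S c (c x) (c y) w"
    using S_eq_iff[OF assms(2,1,3,3) cxy] assms(6) by simp
  finally show False
    using S_pm[OF assms(1,3) cxy] by auto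
qed

lemma good_agree:
  assumes "col c" "col d" "bad c = {}" "bad d = {}" "v \<in> V" "\<And>x. x \<in> star v \<Longrightarrow> c x = d x"
  shows "c = d"
proof -
  \<comment> \<open>The sign belongs to the invariant: agreement on the edge just crossed leaves two
    choices at the next vertex, and the sign, constant along good edges, decides between
    them.\<close>
  let ?P = "\<lambda>w. w \<in> V \<and> (\<forall>x\<in>star w. c x = d x) \<and> S c 1 2 w = S d 1 2 w"
  have "S c 1 2 v = S d 1 2 v"
  proof -
    have *: "ed c v 1 \<in> star v" "c (ed c v 1) = 1" "ed c v 2 \<in> star v" "c (ed c v 2) = 2"
      using assms(1,5) by (auto simp: ed_star col_ed)
    then have "ed c v 1 \<noteq> ed c v 2" by auto
    with * show ?thesis
      using S_mix[OF assms(1,2) *(1,3)] assms(6)[OF *(1)] assms(6)[OF *(3)] by simp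
  qed
  then have v: "?P v" using assms by blast
  have "?P w" if "w \<in> V" for w
  proof -
    have "reach E inc V v w"
      using conn assms(5) that by (auto simp: connected_on_def)
    then show ?thesis
      using v
    proof (induction rule: reach.induct)
      case (step u v' e w)
      then have P: "?P v'" by blast
      have st: "e \<in> star v'" "e \<in> star w" "w \<in> V"
        using step.hyps by (auto simp: star_def)
      have "{bl e, wh e} = {v', w}"
        using inc_eq[OF step.hyps(2)] step.hyps(4) by simp
      then have "(bl e = v' \<and> wh e = w) \<or> (bl e = w \<and> wh e = v')"
        by (auto simp: doubleton_eq_iff)
      moreover have "S f 1 2 (bl e) = S f 1 2 (wh e)" if "bad f = {}" for f
        using that step.hyps(2) by (auto simp: bad_def)
      ultimately have S: "S c 1 2 w = S d 1 2 w"
        using P assms(3,4) by metis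
      have "c x = d x" if "x \<in> star w" for x
        using agree_propagates[OF assms(1,2) st(3,2) _ S that] P st(1) by blast
      then show ?case using S st(3) by blast
    qed simp
  qed
  show ?thesis
  proof
    fix e
    show "c e = d e"
    proof (cases "e \<in> E")
      case True
      then show ?thesis
        using \<open>\<And>w. w \<in> V \<Longrightarrow> ?P w\<close>[OF bl_in[OF True]] by (auto simp: star_iff)
    next
      case False
      then show ?thesis
        using assms(1,2) by (auto simp: proper_edge_col_def)
    qed
  qed
qed

text \<open>Global colour swaps rename the colours of \<open>c\<close> until it matches
  \<open>d\<close> at one vertex; \<open>good_agree\<close> then gives equality.\<close>

lemma good_equiv:
  assumes "col c" "col d" "bad c = {}" "bad d = {}"
  shows "multi_switch\<^sup>*\<^sup>* c d"
proof (cases "V = {}")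
  case True
  then have "E = {}" using bl_in by auto
  then have "c = d" using assms by (auto simp: proper_edge_col_def)
  then show ?thesis by simp
next
  case False
  then obtain v where v: "v \<in> V" by blast
  \<comment> \<open>\<open>x i\<close> is the edge at \<open>v\<close> to which \<open>d\<close>
    gives colour \<open>i\<close>. One swap puts colour 1 on \<open>x 1\<close>, a second puts
    colour 2 on \<open>x 2\<close>, and colour 3 on \<open>x 3\<close> is then forced.\<close>
  define x where "x i = ed d v i" for i
  have x: "x i \<in> star v" "d (x i) = i" if "i \<in> {1..3}" for i
    using ed_star[OF assms(2) v that] col_ed[OF assms(2) v that] by (auto simp: x_def)
  have xE: "x i \<in> E" if "i \<in> {1..3}" for i using x star_E that by blast
  obtain c1 where c1: "multi_switch\<^sup>*\<^sup>* c c1" "col c1" "bad c1 = {}" "c1 (x 1) = 1"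
  proof (cases "c (x 1) = 1")
    case True
    then show ?thesis using that[of c] assms by simp
  next
    case False
    define d1 where "d1 = swap_on c (c (x 1)) 1 (two_col c (c (x 1)) 1)"
    have r: "c (x 1) \<in> {1..3}"
      using col_range[OF xE assms(1), of 1] by simp
    have "multi_switch c d1" "bad d1 = {}" "col d1"
      using full_swap(1-3)[OF assms(1,3) r, of 1] False by (auto simp: d1_def)
    moreover have "d1 (x 1) = 1"
      using full_swap(4)[OF assms(1,3) r, of 1 "x 1"] xE[of 1] False by (simp add: d1_def)
    ultimately show ?thesis
      using that[of d1] by blast
  qed
  have rg: "f (x i) \<in> {1..3}" if "col f" "i \<in> {1..3}" for f i
    using col_range[OF xE[OF that(2)] that(1)] .
  have dist: "f (x i) \<noteq> f (x j)" if "col f" "i \<in> {1..3}" "j \<in> {1..3}" "i \<noteq> j" for f i j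
    using star_inj[OF that(1) v x(1) x(1)] x(2) that by metis
  obtain c2 where c2: "multi_switch\<^sup>*\<^sup>* c c2" "col c2" "bad c2 = {}" "c2 (x 1) = 1" "c2 (x 2) = 2"
  proof (cases "c1 (x 2) = 2")
    case True
    then show ?thesis using that[of c1] c1 by simp
  next
    case False
    then have "c1 (x 2) = 3"
      using rg[OF c1(2), of 2] dist[OF c1(2), of 1 2] c1(4) by auto
    define d2 where "d2 = swap_on c1 2 3 (two_col c1 2 3)"
    have *: "multi_switch c1 d2" "bad d2 = {}" "col d2"
      using full_swap(1-3)[OF c1(2,3), of 2 3] by (auto simp: d2_def)
    have "d2 (x 1) = 1" "d2 (x 2) = 2"
      using full_swap(4)[OF c1(2,3), of 2 3] xE[of 1] xE[of 2] c1(4) \<open>c1 (x 2) = 3\<close>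
      by (auto simp: d2_def)
    then show ?thesis
      using * that[of d2] c1(1) by (meson rtranclp.rtrancl_into_rtrancl)
  qed
  have c3: "c2 (x 3) = 3"
    using rg[OF c2(2), of 3] dist[OF c2(2), of 1 3] dist[OF c2(2), of 2 3] c2(4,5) by auto
  have "c2 y = d y" if "y \<in> star v" for y
  proof -
    have "y = x (d y)" 
      using star_inj[OF assms(2) v that x(1)] x(2) col_range[OF star_E[OF that] assms(2)] by metis
    moreover have "d y \<in> {1,2,3}"
      using col_range[OF star_E[OF that] assms(2)] by auto
    ultimately show ?thesis
      using c2(4,5) c3 by (metis empty_iff insert_iff)
  qed
  then have "c2 = d"
    using good_agree[OF c2(2) assms(2) c2(3) assms(4) v] by blast
  then show ?thesis using c2(1) by simp
qed

theorem all_equiv: "(kempe_switch E inc 3)\<^sup>*\<^sup>* c d" if "col c" "col d"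
proof -
  obtain c' d' where *: "multi_switch\<^sup>*\<^sup>* c c'" "bad c' = {}" "multi_switch\<^sup>*\<^sup>* d d'" "bad d' = {}"
    using reach_good[OF \<open>col c\<close>] reach_good[OF \<open>col d\<close>] by auto
  then have "multi_switch\<^sup>*\<^sup>* c' d'"
    using good_equiv multi_switches_col that by blast
  with * have "multi_switch\<^sup>*\<^sup>* c d"
    using multi_switches_sym by (meson rtranclp_trans)
  then show ?thesis by (rule multi_switches_kempe)
qed

end

section \<open>Vertex signs from a plane drawing\<close>

text \<open>An injective self-map of a finite set is a permutation, so the orbit of \<open>v\<close>
  is a cycle; \<open>m\<close> is its length.\<close>

lemma inj_orbit:
  assumes "finite B" "inj_on f B" "f ` B \<subseteq> B" "v \<in> B"
  shows "\<exists>m>0. (f ^^ m) v = v \<and> inj_on (\<lambda>i. (f ^^ i) v) {..<m}"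
proof -
  \<comment> \<open>Extension by the identity makes the map injective on the whole type, as
    \<open>funpow_inj_finite\<close> demands.\<close>
  define F where "F x = (if x \<in> B then f x else x)" for x
  have injF: "inj F"
    unfolding inj_def F_def using assms(2,3) by (auto simp: inj_on_def)
  have FB: "(F ^^ n) v = (f ^^ n) v \<and> (f ^^ n) v \<in> B" for n
    by (induction n) (use assms(3,4) in \<open>auto simp: F_def\<close>)
  have "finite {y. \<exists>n. y = (F ^^ n) v}"
    by (rule finite_subset[OF _ assms(1)]) (use FB in auto)
  then obtain n where n: "n > 0" "(F ^^ n) v = v"
    using funpow_inj_finite[OF injF] by metis
  define m where "m = (LEAST m. m > 0 \<and> (F ^^ m) v = v)"
  have m: "m > 0" "(F ^^ m) v = v"
    using LeastI[of "\<lambda>m. m > 0 \<and> (F ^^ m) v = v" n] n by (auto simp: m_def)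
  have less: "\<not> (k > 0 \<and> (F ^^ k) v = v)" if "k < m" for k
    using not_less_Least that unfolding m_def by blast
  have "False" if "i < j" "j < m" "(F ^^ i) v = (F ^^ j) v" for i j
  proof -
    have "(F ^^ j) v = (F ^^ i) ((F ^^ (j - i)) v)"
      using that(1) by (metis add_diff_inverse_nat comp_apply funpow_add not_less_iff_gr_or_eq)
    then have "(F ^^ (j - i)) v = v"
      using inj_fn[OF injF, of i] that(3) by (metis injD)
    moreover have "j - i < m" "0 < j - i" using that by auto
    ultimately show False using less[of "j - i"] by blast
  qed
  then have "inj_on (\<lambda>i. (F ^^ i) v) {..<m}"
    unfolding inj_on_def by (metis lessThan_iff linorder_neqE_nat)
  with m FB show ?thesis by auto
qed

locale plane_bip_cubic = bip_cubic V E inc bl wh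
  for V :: "'v set" and E :: "'e set" and inc :: "'e \<Rightarrow> 'v set" and bl wh :: "'e \<Rightarrow> 'v" +
  fixes p :: "'v \<Rightarrow> complex" and \<gamma> :: "'e \<Rightarrow> real \<Rightarrow> complex"
  assumes inj_p: "inj_on p V"
    and arc_g: "e \<in> E \<Longrightarrow> arc (\<gamma> e)"
    and start_g: "e \<in> E \<Longrightarrow> pathstart (\<gamma> e) = p (bl e)"
    and finish_g: "e \<in> E \<Longrightarrow> pathfinish (\<gamma> e) = p (wh e)"
    and image_V: "e \<in> E \<Longrightarrow> path_image (\<gamma> e) \<inter> p ` V = p ` inc e"
    and cross: "e \<in> E \<Longrightarrow> f \<in> E \<Longrightarrow> e \<noteq> f \<Longrightarrow>
      path_image (\<gamma> e) \<inter> path_image (\<gamma> f) \<subseteq> p ` (inc e \<inter> inc f)"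
    and conn: "connected_on E inc V"
begin

definition supp :: "'e set \<Rightarrow> complex set" where
  "supp X = (\<Union>e\<in>X. path_image (\<gamma> e))"

text \<open>For a chain this is the winding number of the curve that runs from black to white along
  colour \<open>a\<close> and from white to black along the other colour. Written as a sum it needs
  no order of traversal, and single edges can be split off.\<close>

definition wsum :: "('e \<Rightarrow> nat) \<Rightarrow> nat \<Rightarrow> 'e set \<Rightarrow> complex \<Rightarrow> complex" where
  "wsum c a X z = (\<Sum>e\<in>X. (if c e = a then 1 else - 1) * winding_number (\<gamma> e) z)"

lemma path_g: "e \<in> E \<Longrightarrow> path (\<gamma> e)"
  using arc_g arc_imp_path by blast

lemma supp_Int:
  assumes "X \<subseteq> E" "f \<in> E" "f \<notin> X" "\<And>e. e \<in> X \<Longrightarrow> inc e \<inter> inc f \<subseteq> W"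
  shows "supp X \<inter> path_image (\<gamma> f) \<subseteq> p ` W"
proof
  fix z assume "z \<in> supp X \<inter> path_image (\<gamma> f)"
  then obtain e where e: "e \<in> X" "z \<in> path_image (\<gamma> e) \<inter> path_image (\<gamma> f)"
    by (auto simp: supp_def)
  then have "z \<in> p ` (inc e \<inter> inc f)"
    using cross[of e f] assms by blast
  then show "z \<in> p ` W"
    using assms(4)[OF e(1)] by blast
qed

text \<open>The edges of a bichromatic chain through the black vertex \<open>vs 0\<close>, listed as
  \<open>x 0\<close> (colour \<open>a\<close>), \<open>y 1\<close> (colour \<open>b\<close>), \<open>x 1\<close>, \<open>y 2\<close>, \dots, so that \<open>x i\<close> and \<open>y i\<close> meet in the
  black vertex \<open>vs i\<close>, and \<open>x i\<close> and \<open>y (i + 1)\<close> in a white one.\<close>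
lemma chain_enum:
  assumes c: "col c" "a \<in> {1..3}" "b \<in> {1..3}" "a \<noteq> b" and C: "chain c a b C"
  obtains m vs x y where "m > 0" "C = x ` {..<m} \<union> y ` {..<m}"
    "\<And>i::nat. x i \<in> E \<and> y i \<in> E \<and> c (x i) = a \<and> c (y i) = b \<and> bl (x i) = vs i \<and> bl (y i) = vs i
       \<and> wh (y (Suc i)) = wh (x i)"
    "y m = y 0" "inj_on vs {..<m}"
proof -
  obtain e where e: "e \<in> C" "e \<in> E"
    using chain_ne[OF C] chain_subset[OF C] by (auto simp: two_col_def)
  \<comment> \<open>The next black vertex on the chain: along the \<open>a\<close>-edge to its white
    end, then back along the \<open>b\<close>-edge there.\<close>
  define f where "f v = bl (ed c (wh (ed c v a)) b)" for v
  let ?B = "bl ` E"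
  have BV: "v \<in> V" if "v \<in> ?B" for v using that bl_in by auto
  have blst: "bl g = v" if g: "g \<in> star v" and v: "v \<in> ?B" for g v
  proof -
    obtain h where "h \<in> E" "v = bl h" using v by blast
    then show ?thesis using g bl_neq_wh[of h g] by (auto simp: star_iff)
  qed
  have whst: "wh g = wh h" if "g \<in> star (wh h)" "h \<in> E" for g h
    using that bl_neq_wh[of g h] by (auto simp: star_iff)
  have ab: "i \<in> {1..3}" if "i = a \<or> i = b" for i using that c(2,3) by blast
  have A: "ed c v i \<in> star v" "c (ed c v i) = i" "ed c v i \<in> E" if "v \<in> V" "i = a \<or> i = b" for v i
    using ed_star[OF c(1) that(1) ab[OF that(2)]] col_ed[OF c(1) that(1) ab[OF that(2)]]
    by (simp_all add: star_E)
  have whV: "wh g \<in> V" if "g \<in> E" for g using wh_in that .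
  have fB: "f ` ?B \<subseteq> ?B"
    unfolding f_def using A(3) BV whV by blast
  have step: "bl (ed c v a) = v" "bl (ed c v b) = v" "ed c (f v) b = ed c (wh (ed c v a)) b"
    "wh (ed c (f v) b) = wh (ed c v a)" "ed c (wh (ed c v a)) a = ed c v a" if v: "v \<in> ?B" for v
  proof -
    let ?x = "ed c v a" let ?y = "ed c (wh ?x) b"
    note x = A[OF BV[OF v] disjI1[OF HOL.refl]] and x' = A[OF BV[OF v] disjI2[OF HOL.refl]]
    have y: "?y \<in> star (wh ?x)" "c ?y = b" "?y \<in> E"
      using A[OF whV[OF x(3)] disjI2[OF HOL.refl]] by blast+
    show "bl ?x = v" "bl (ed c v b) = v"
      using blst[OF x(1) v] blst[OF x'(1) v] by simp_all
    have "?y \<in> star (bl ?y)" using y(3) by (simp add: star_iff)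
    then show *: "ed c (f v) b = ?y"
      unfolding f_def using ed_eq[OF c(1) bl_in[OF y(3)] _ y(2)] by simp
    show "wh (ed c (f v) b) = wh ?x"
      unfolding * using whst[OF y(1) x(3)] .
    have "?x \<in> star (wh ?x)" using x by (simp add: star_iff)
    then show "ed c (wh ?x) a = ?x"
      using ed_eq[OF c(1) whV[OF x(3)] _ x(2)] by simp
  qed
  have "inj_on f ?B"
  proof (rule inj_onI)
    fix v w assume vw: "v \<in> ?B" "w \<in> ?B" "f v = f w"
    then have "wh (ed c v a) = wh (ed c w a)"
      using step(4) by metis
    then have "ed c v a = ed c w a"
      using step(5) vw by metis
    then show "v = w" using step(1) vw by metis
  qed
  moreover have v0: "bl e \<in> ?B" using e by blast
  ultimately obtain m where m: "m > 0" "(f ^^ m) (bl e) = bl e" "inj_on (\<lambda>i. (f ^^ i) (bl e)) {..<m}"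
    using inj_orbit[OF _ _ fB] finite_E by blast
  define vs where "vs i = (f ^^ i) (bl e)" for i
  define x where "x i = ed c (vs i) a" for i
  define y where "y i = ed c (vs i) b" for i
  have vB: "vs i \<in> ?B" for i
    by (induction i) (use v0 fB in \<open>auto simp: vs_def\<close>)
  have xy: "x i \<in> E \<and> y i \<in> E \<and> c (x i) = a \<and> c (y i) = b \<and> bl (x i) = vs i \<and> bl (y i) = vs i
       \<and> wh (y (Suc i)) = wh (x i)" for i
  proof -
    have "vs (Suc i) = f (vs i)" by (simp add: vs_def)
    then show ?thesis
      using A[OF BV[OF vB[of i]]] step(1,2,4)[OF vB[of i]] by (simp add: x_def y_def)
  qed
  have y': "y (Suc i) = ed c (wh (x i)) b" for i
    using step(3)[OF vB[of i]] by (simp add: y_def x_def vs_def)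
  have x': "ed c (wh (x i)) a = x i" for i
    using step(5)[OF vB[of i]] by (simp add: x_def)
  have period: "vs i = vs (i mod m)" for i
    using funpow_mod_eq[OF m(2), of i] by (simp add: vs_def)
  let ?X = "range x \<union> range y"
  have im: "range x = x ` {..<m}" "range y = y ` {..<m}"
    using period m(1) by (auto simp: x_def y_def) (metis imageI lessThan_iff mod_less_divisor)+
  \<comment> \<open>A saturated set containing \<open>e\<close> contains the whole chain. The other
    inclusion comes later, by walking along the enumeration.\<close>
  have sat: "saturated c a b ?X"
    unfolding saturated_def
  proof (intro conjI ballI impI)
    show "?X \<subseteq> two_col c a b" using xy by (auto simp: two_col_def)
    fix g h assume gh: "g \<in> ?X" "h \<in> two_col c a b" "inc g \<inter> inc h \<noteq> {}"
    then have "g \<in> E" using xy by auto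
    then obtain v where v: "v \<in> V" "g \<in> star v" "h \<in> star v"
      using adj_iff gh by (auto simp: two_col_def)
    have h: "h = ed c v a \<or> h = ed c v b"
      using ed_eq[OF c(1) v(1,3)] gh(2) by (auto simp: two_col_def)
    \<comment> \<open>\<open>y 0\<close> has a predecessor too, because it equals
      \<open>y m\<close>.\<close>
    have ys: "\<exists>j. y i = y (Suc j)" for i
    proof (cases i)
      case 0
      then have "y i = y m" using period[of m] by (simp add: y_def)
      then show ?thesis using m(1) gr0_implies_Suc by metis
    qed auto
    obtain i where i: "g = x i \<or> g = y i" using gh(1) by blast
    have "v = vs i \<or> (\<exists>j. v = wh (x j))"
    proof (cases "v = bl g")
      case True
      then show ?thesis using i xy[of i] by metis
    next
      case False
      then have v': "v = wh g" using v(2) by (simp add: star_iff)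
      show ?thesis
      proof (cases "g = x i")
        case True
        then show ?thesis using v' by blast
      next
        case False
        then have "g = y i" using i by blast
        then show ?thesis using ys[of i] xy v' by metis
      qed
    qed
    then show "h \<in> ?X"
    proof
      assume "v = vs i"
      then have "h = x i \<or> h = y i" using h by (simp add: x_def y_def)
      then show ?thesis by blast
    next
      assume "\<exists>j. v = wh (x j)"
      then obtain j where "v = wh (x j)" by blast
      then have "h = x j \<or> h = y (Suc j)" using h x' y' by metis
      then show ?thesis by blast
    qed
  qed
  have "e = x 0 \<or> e = y 0"
  proof -
    have "e \<in> star (bl e)" using e by (simp add: star_iff)
    then show ?thesis
      using ed_eq[OF c(1) bl_in[OF e(2)]] chain_subset[OF C] e(1)
      by (fastforce simp: x_def y_def vs_def two_col_def)
  qed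
  then have "e \<in> ?X" by blast
  then have CX: "C \<subseteq> ?X" using chain_sub_saturated[OF C sat e(1)] by blast
  have adjC: "h \<in> C" if "g \<in> C" "h \<in> two_col c a b" "inc g \<inter> inc h \<noteq> {}" for g h
    using chain_saturated[OF C] that by (auto simp: saturated_def)
  have two: "x i \<in> two_col c a b" "y i \<in> two_col c a b" for i
    using xy by (auto simp: two_col_def)
  have meet: "inc (x i) \<inter> inc (y i) \<noteq> {}" "inc (x i) \<inter> inc (y (Suc i)) \<noteq> {}" for i
    using xy[of i] xy[of "Suc i"] inc_eq by auto
  have "x 0 \<in> C"
    using \<open>e = x 0 \<or> e = y 0\<close> e(1) adjC[OF _ two(1), of e 0] meet(1)[of 0] by (auto simp: Int_commute)
  then have "x i \<in> C" for i
  proof (induction i)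
    case (Suc i)
    have "y (Suc i) \<in> C" by (rule adjC[OF Suc.IH[OF Suc.prems] two(2) meet(2)])
    then show ?case
      using adjC[OF _ two(1), of "y (Suc i)" "Suc i"] meet(1)[of "Suc i"] by (simp add: Int_commute)
  qed
  then have "?X \<subseteq> C" using adjC[OF _ two(2) meet(1)] by blast
  with CX im have "C = x ` {..<m} \<union> y ` {..<m}" by auto
  moreover have "y m = y 0" using period[of m] by (simp add: y_def)
  moreover have "inj_on vs {..<m}" using m(3) by (simp add: vs_def[abs_def])
  ultimately show ?thesis using that[of m x y vs] m(1) xy by blast
qed


text \<open>By \<open>chain_enum\<close> the chain is a closed alternating walk without repeated
  vertices, so its arcs join to a simple closed path, whose winding number is \<open>wsum\<close>
  off the curve.\<close>

lemma chain_jordan: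
  assumes c: "col c" "a \<in> {1..3}" "b \<in> {1..3}" "a \<noteq> b" and C: "chain c a b C"
  shows "\<exists>\<omega>. jordan_fun (supp C) (wsum c a C) \<omega> \<and> connected (supp C)"
proof (rule chain_enum[OF c C])
  fix m and vs :: "nat \<Rightarrow> 'v" and x y :: "nat \<Rightarrow> 'e"
  assume m: "m > 0" "C = x ` {..<m} \<union> y ` {..<m}"
    and xy: "\<And>i::nat. x i \<in> E \<and> y i \<in> E \<and> c (x i) = a \<and> c (y i) = b \<and> bl (x i) = vs i \<and> bl (y i) = vs i
       \<and> wh (y (Suc i)) = wh (x i)"
    and ym: "y m = y 0" and inj: "inj_on vs {..<m}"
  have xE: "x i \<in> E" "y i \<in> E" "c (x i) = a" "c (y i) = b" "bl (x i) = vs i" "bl (y i) = vs i" for i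
    using xy by auto
  have wy: "wh (y (Suc i)) = wh (x i)" for i using xy by blast
  have inc_x: "inc (x i) = {vs i, wh (x i)}" for i
    using inc_eq xE by metis
  have inc_y: "inc (y (Suc i)) = {vs (Suc i), wh (x i)}" for i
    using inc_eq xE wy by metis
  have vs_inj: "vs i = vs j \<Longrightarrow> i = j" if "i < m" "j < m" for i j
    using inj that by (auto simp: inj_on_def)
  have wh_inj: "i = j" if "wh (x i) = wh (x j)" "i < m" "j < m" for i j
  proof -
    have "x i \<in> star (wh (x i))" "x j \<in> star (wh (x i))"
      using xE that(1) by (auto simp: star_iff)
    then have "x i = x j"
      using star_inj[OF c(1) wh_in[OF xE(1)]] xE(3) by metis
    then show ?thesis using xE(5) vs_inj that by metis
  qed
  have vs_wh: "vs i \<noteq> wh (x j)" "wh (x j) \<noteq> vs i" for i j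
    using bl_neq_wh xE by metis+
  have neq_xy: "x i \<noteq> y j" for i j
    using xE(3,4) c(4) by metis
  have neq_x: "x i \<noteq> x j" "y i \<noteq> y j" if "i < m" "j < m" "i \<noteq> j" for i j
    using xE(5,6) vs_inj that by metis+
  \<comment> \<open>\<open>T n\<close> follows \<open>x 0\<close>, then \<open>y 1\<close>
    backwards, \<open>x 1\<close>, and so on up to \<open>x n\<close>; \<open>D n\<close> below is
    its set of edges. \<open>y 0\<close> is reserved for closing the loop.\<close>
  define T where "T = rec_nat (\<gamma> (x 0)) (\<lambda>n g. g +++ (reversepath (\<gamma> (y (Suc n))) +++ \<gamma> (x (Suc n))))"
  have T: "T 0 = \<gamma> (x 0)" "T (Suc n) = T n +++ (reversepath (\<gamma> (y (Suc n))) +++ \<gamma> (x (Suc n)))" for n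
    by (simp_all add: T_def)
  define D where "D n = x ` {..n} \<union> y ` {1..n}" for n
  have D: "D 0 = {x 0}" "D (Suc n) = D n \<union> {y (Suc n), x (Suc n)}" for n
    by (auto simp: D_def atMost_Suc atLeastAtMostSuc_conv)
  have DE: "D n \<subseteq> E" for n using xE by (auto simp: D_def)
  have main: "arc (T n) \<and> pathstart (T n) = p (vs 0) \<and> pathfinish (T n) = p (wh (x n)) \<and>
    path_image (T n) = supp (D n) \<and> (\<forall>z. z \<notin> supp (D n) \<longrightarrow> winding_number (T n) z =
      (\<Sum>i\<le>n. winding_number (\<gamma> (x i)) z) - (\<Sum>i=1..n. winding_number (\<gamma> (y i)) z))" if "n < m" for n
    using that
  proof (induction n)
    case 0
    then show ?case
      using arc_g[OF xE(1)] start_g[OF xE(1)] finish_g[OF xE(1)] xE(5) by (simp add: T D supp_def)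
  next
    case (Suc n)
    let ?x = "x (Suc n)" and ?y = "y (Suc n)" and ?Q = "reversepath (\<gamma> (y (Suc n))) +++ \<gamma> (x (Suc n))"
    have IH: "arc (T n)" "pathstart (T n) = p (vs 0)" "pathfinish (T n) = p (wh (x n))"
      "path_image (T n) = supp (D n)"
      "\<And>z. z \<notin> supp (D n) \<Longrightarrow> winding_number (T n) z =
        (\<Sum>i\<le>n. winding_number (\<gamma> (x i)) z) - (\<Sum>i=1..n. winding_number (\<gamma> (y i)) z)"
      using Suc by auto
    have ends: "pathstart (\<gamma> ?x) = p (vs (Suc n))" "pathfinish (\<gamma> ?x) = p (wh ?x)"
      "pathstart (\<gamma> ?y) = p (vs (Suc n))" "pathfinish (\<gamma> ?y) = p (wh (x n))"
      using start_g finish_g xE wy by metis+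
    have arcs: "arc (\<gamma> ?x)" "arc (\<gamma> ?y)" "path (\<gamma> ?x)" "path (\<gamma> ?y)"
      using arc_g path_g xE by auto
    have "inc ?y \<inter> inc ?x \<subseteq> {vs (Suc n)}"
      using wh_inj[of n "Suc n"] Suc.prems vs_wh by (auto simp: inc_x inc_y)
    then have yx: "path_image (\<gamma> ?y) \<inter> path_image (\<gamma> ?x) \<subseteq> {p (vs (Suc n))}"
      using cross[OF xE(2,1), of "Suc n" "Suc n"] neq_xy[of "Suc n" "Suc n"] by fastforce
    have Q: "arc ?Q" "pathstart ?Q = p (wh (x n))" "pathfinish ?Q = p (wh ?x)"
      "path_image ?Q = path_image (\<gamma> ?y) \<union> path_image (\<gamma> ?x)"
      using arcs ends yx by (auto intro!: arc_join simp: arc_reversepath path_image_join)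
    have Dx: "(\<exists>i<Suc n. e = x i) \<or> (\<exists>i<n. e = y (Suc i))" if e: "e \<in> D n" for e
    proof -
      consider i where "i \<le> n" "e = x i" | i where "1 \<le> i" "i \<le> n" "e = y i"
        using e unfolding D_def by (auto simp: image_iff)
      then show ?thesis
      proof cases
        case (2 i)
        then have "i - 1 < n" "e = y (Suc (i - 1))" by auto
        then show ?thesis by blast
      qed (use le_imp_less_Suc in blast)
    qed
    have notin: "?x \<notin> D n" "?y \<notin> D n"
    proof -
      have "x i \<noteq> ?x" if "i < Suc n" for i
        using neq_x(1)[of i "Suc n"] that Suc.prems by simp
      then show "?x \<notin> D n" using Dx[of ?x] neq_xy by metis
      have "y (Suc i) \<noteq> ?y" if "i < n" for i
        using neq_x(2)[of "Suc i" "Suc n"] that Suc.prems by simp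
      then show "?y \<notin> D n" using Dx[of ?y] neq_xy by metis
    qed
    \<comment> \<open>The old path and the two new edges share only the vertex where they are
      joined, since the black vertices, and likewise the white ones, are distinct for indices below
      \<open>m\<close>.\<close>
    have inc1: "inc e \<inter> inc ?y \<subseteq> {wh (x n)}" "inc e \<inter> inc ?x \<subseteq> {wh (x n)}" if e: "e \<in> D n" for e
    proof -
      consider i where "i < Suc n" "e = x i" | i where "i < n" "e = y (Suc i)"
        using Dx[OF e] by blast
      then have "inc e \<inter> inc ?y \<subseteq> {wh (x n)} \<and> inc e \<inter> inc ?x \<subseteq> {wh (x n)}"
      proof cases
        case 1
        then show ?thesis
          using Suc.prems vs_inj[of i "Suc n"] wh_inj[of i "Suc n"] vs_wh by (auto simp: inc_x inc_y)
      next
        case 2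
        then show ?thesis
          using Suc.prems vs_inj[of "Suc i" "Suc n"] wh_inj[of i "Suc n"] wh_inj[of i n] vs_wh
          by (auto simp: inc_x inc_y)
      qed
      then show "inc e \<inter> inc ?y \<subseteq> {wh (x n)}" "inc e \<inter> inc ?x \<subseteq> {wh (x n)}" by auto
    qed
    have TQ: "path_image (T n) \<inter> path_image ?Q \<subseteq> {p (wh (x n))}"
      using supp_Int[OF DE xE(1) notin(1) inc1(2)] supp_Int[OF DE xE(2) notin(2) inc1(1)]
      by (auto simp: IH(4) Q(4))
    have "arc (T (Suc n))"
      unfolding T by (rule arc_join) (use IH Q TQ in simp_all)
    moreover have img: "path_image (T (Suc n)) = supp (D (Suc n))"
      using IH Q by (auto simp: T D supp_def path_image_join)
    moreover have "winding_number (T (Suc n)) z =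
      (\<Sum>i\<le>Suc n. winding_number (\<gamma> (x i)) z) - (\<Sum>i=1..Suc n. winding_number (\<gamma> (y i)) z)"
      if z: "z \<notin> supp (D (Suc n))" for z
    proof -
      have z': "z \<notin> supp (D n)" "z \<notin> path_image (\<gamma> ?x)" "z \<notin> path_image (\<gamma> ?y)"
        using z by (auto simp: D supp_def)
      have "winding_number (T (Suc n)) z = winding_number (T n) z + winding_number ?Q z"
        unfolding T by (rule winding_number_join) (use IH Q z' arc_imp_path in \<open>simp_all del: pathstart_join pathfinish_join\<close>)
      also have "winding_number ?Q z = winding_number (reversepath (\<gamma> ?y)) z + winding_number (\<gamma> ?x) z"
        by (rule winding_number_join) (use arcs ends z' in simp_all)
      also have "winding_number (reversepath (\<gamma> ?y)) z = - winding_number (\<gamma> ?y) z"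
        by (rule winding_number_reversepath) (use arcs z' in simp_all)
      finally show ?thesis
        using IH(5)[OF z'(1)] by simp
    qed
    ultimately show ?case
      using IH Q by (simp add: T)
  qed
  obtain k where k: "m = Suc k" using m(1) gr0_implies_Suc by blast
  \<comment> \<open>\<open>T k\<close> ends at the white end of \<open>y 0\<close>, whose reversal
    leads back to \<open>vs 0\<close>. For \<open>m = 1\<close> the loop consists of two parallel
    edges.\<close>
  let ?g = "T k +++ reversepath (\<gamma> (y 0))"
  have Tk: "arc (T k)" "pathstart (T k) = p (vs 0)" "pathfinish (T k) = p (wh (x k))"
      "path_image (T k) = supp (D k)"
      "\<And>z. z \<notin> supp (D k) \<Longrightarrow> winding_number (T k) z =
        (\<Sum>i\<le>k. winding_number (\<gamma> (x i)) z) - (\<Sum>i=1..k. winding_number (\<gamma> (y i)) z)"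
    using main[of k] k by auto
  have wy0: "wh (y 0) = wh (x k)" using wy[of k] ym k by simp
  have y0: "arc (\<gamma> (y 0))" "path (\<gamma> (y 0))" "pathstart (\<gamma> (y 0)) = p (vs 0)" "pathfinish (\<gamma> (y 0)) = p (wh (x k))"
    using arc_g path_g start_g finish_g xE wy0 by metis+
  have y0D: "y 0 \<notin> D k"
    using neq_xy neq_x k by (auto simp: D_def) (metis Suc_le_eq le_imp_less_Suc not_one_le_zero zero_less_Suc)
  have "supp (D k) \<inter> path_image (\<gamma> (y 0)) \<subseteq> p ` {vs 0, wh (x k)}"
    by (rule supp_Int[OF DE xE(2) y0D]) (use inc_eq[OF xE(2)] xE(6) wy0 in auto)
  then have g: "simple_path ?g" "pathfinish ?g = pathstart ?g"
    using Tk y0 by (auto intro!: simple_path_join_loop simp: arc_reversepath)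
  have CD: "C = insert (y 0) (D k)"
  proof -
    have "{..<m} = {..k}" "{..k} = insert 0 {1..k}" using k by auto
    then have "x ` {..<m} = x ` {..k}" "y ` {..<m} = insert (y 0) (y ` {1..k})" by (metis, metis image_insert)
    then show ?thesis unfolding m(2) D_def by simp
  qed
  have img: "path_image ?g = supp C"
    using Tk y0 by (auto simp: CD supp_def path_image_join)
  have "winding_number ?g z = wsum c a C z" if z: "z \<notin> supp C" for z
  proof -
    have z': "z \<notin> supp (D k)" "z \<notin> path_image (\<gamma> (y 0))"
      using z by (auto simp: CD supp_def)
    have "winding_number ?g z = winding_number (T k) z + winding_number (reversepath (\<gamma> (y 0))) z"
      by (rule winding_number_join) (use Tk y0 z' arc_imp_path in simp_all)
    also have "winding_number (reversepath (\<gamma> (y 0))) z = - winding_number (\<gamma> (y 0)) z"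
      by (rule winding_number_reversepath) (use y0 z' in simp_all)
    finally have 1: "winding_number ?g z = (\<Sum>i\<le>k. winding_number (\<gamma> (x i)) z)
        - (\<Sum>i=1..k. winding_number (\<gamma> (y i)) z) - winding_number (\<gamma> (y 0)) z"
      using Tk(5)[OF z'(1)] by simp
    have injx: "inj_on x {..k}" "inj_on y {1..k}"
      using neq_x k by (auto simp: inj_on_def) (metis le_imp_less_Suc)+
    have sx: "(\<Sum>e\<in>x ` {..k}. (if c e = a then 1 else - 1) * winding_number (\<gamma> e) z)
        = (\<Sum>i\<le>k. winding_number (\<gamma> (x i)) z)"
      using injx(1) xE(3) by (simp add: sum.reindex)
    have sy: "(\<Sum>e\<in>y ` {1..k}. (if c e = a then 1 else - 1) * winding_number (\<gamma> e) z)
        = - (\<Sum>i=1..k. winding_number (\<gamma> (y i)) z)"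
      using injx(2) xE(4) c(4) by (simp add: sum.reindex sum_negf)
    have fin: "finite (D k)" by (simp add: D_def)
    have "x ` {..k} \<inter> y ` {1..k} = {}" using neq_xy by auto
    then have "wsum c a (D k) z = (\<Sum>i\<le>k. winding_number (\<gamma> (x i)) z)
        - (\<Sum>i=1..k. winding_number (\<gamma> (y i)) z)"
      unfolding wsum_def D_def using sx sy by (simp add: sum.union_disjoint)
    moreover have "wsum c a C z = - winding_number (\<gamma> (y 0)) z + wsum c a (D k) z"
      unfolding wsum_def CD using y0D fin xE(4) c(4) by simp
    ultimately have "wsum c a C z = - winding_number (\<gamma> (y 0)) z + ((\<Sum>i\<le>k. winding_number (\<gamma> (x i)) z)
        - (\<Sum>i=1..k. winding_number (\<gamma> (y i)) z))" by simp
    with 1 show ?thesis by simp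
  qed
  moreover obtain \<omega> where "jordan_fun (supp C) (winding_number ?g) \<omega>"
    using jordan_fun_winding_number[OF g] unfolding img by blast
  moreover have "connected (supp C)"
    using connected_path_image[of ?g] g(1) img by (simp add: simple_path_imp_path)
  ultimately show "\<exists>\<omega>. jordan_fun (supp C) (wsum c a C) \<omega> \<and> connected (supp C)"
    using jordan_fun_cong by metis
qed


section \<open>The sign of a vertex as a jump of the winding number\<close>

definition oarc :: "'e \<Rightarrow> complex set" where
  "oarc e = \<gamma> e ` {0<..<1}"

text \<open>A sample point of the open arc: the function of a chain not containing the edge is
  constant along that arc.\<close>

definition mid :: "'e \<Rightarrow> complex" where
  "mid e = \<gamma> e (1/2)"

definition loop_sign :: "('e \<Rightarrow> nat) \<Rightarrow> nat \<Rightarrow> 'e set \<Rightarrow> complex" where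
  "loop_sign c a C = (SOME \<omega>. jordan_fun (supp C) (wsum c a C) \<omega>)"

definition chain_at :: "('e \<Rightarrow> nat) \<Rightarrow> nat \<Rightarrow> nat \<Rightarrow> 'v \<Rightarrow> 'e set" where
  "chain_at c a b v = {f. (ed c v a, f) \<in> (adj c a b)\<^sup>*}"

text \<open>The colours are 1, 2, 3, so \<open>6 - a - b\<close> is the third colour.\<close>
definition S :: "('e \<Rightarrow> nat) \<Rightarrow> nat \<Rightarrow> nat \<Rightarrow> 'v \<Rightarrow> complex" where
  "S c a b v = 2 * wsum c a (chain_at c a b v) (mid (ed c v (6 - a - b))) - loop_sign c a (chain_at c a b v)"

lemma loop_sign: "jordan_fun (supp C) (wsum c a C) (loop_sign c a C)"
  if "col c" "a \<in> {1..3}" "b \<in> {1..3}" "a \<noteq> b" "chain c a b C"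
  unfolding loop_sign_def using chain_jordan[OF that] by (metis (mono_tags) someI)

lemma mid_oarc: "mid e \<in> oarc e"
  by (auto simp: mid_def oarc_def)

lemma oarc_sub: "oarc e \<subseteq> path_image (\<gamma> e)"
  by (auto simp: oarc_def path_image_def)

lemma cont_g: "continuous_on {0..1} (\<gamma> e)" if "e \<in> E"
  using path_g[OF that] by (simp add: path_def)

lemma connected_oarc: "connected (oarc e)" if "e \<in> E"
  unfolding oarc_def
  by (intro connected_continuous_image continuous_on_subset[OF cont_g[OF that]]) auto

lemma closure_oarc: "v \<in> inc e \<Longrightarrow> p v \<in> closure (oarc e)" if e: "e \<in> E"
proof -
  have "\<gamma> e ` closure {0<..<1} \<subseteq> closure (oarc e)"
    unfolding oarc_def
    by (rule image_closure_subset) (use cont_g[OF e] closure_subset in \<open>simp_all add: closure_greaterThanLessThan\<close>)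
  then have "\<gamma> e 0 \<in> closure (oarc e)" "\<gamma> e 1 \<in> closure (oarc e)" by auto
  then show "v \<in> inc e \<Longrightarrow> p v \<in> closure (oarc e)"
    using inc_eq[OF e] start_g[OF e] finish_g[OF e] by (auto simp: pathstart_def pathfinish_def)
qed

lemma oarc_V: "oarc e \<inter> p ` V = {}" if e: "e \<in> E"
proof -
  have "\<gamma> e t \<noteq> p v" if t: "t \<in> {0<..<1}" "v \<in> V" for t v
  proof
    assume eq: "\<gamma> e t = p v"
    have "\<gamma> e t \<in> path_image (\<gamma> e)" using t(1) by (auto simp: path_image_def)
    then have "\<gamma> e t \<in> path_image (\<gamma> e) \<inter> p ` V" using eq t(2) by auto
    then have "\<gamma> e t = \<gamma> e 0 \<or> \<gamma> e t = \<gamma> e 1"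
      using image_V[OF e] inc_eq[OF e] start_g[OF e] finish_g[OF e] by (auto simp: pathstart_def pathfinish_def)
    moreover have "inj_on (\<gamma> e) {0..1}" using arc_g[OF e] by (simp add: arc_def)
    ultimately show False
      using t(1) inj_onD[of "\<gamma> e" "{0..1}" t 0] inj_onD[of "\<gamma> e" "{0..1}" t 1] by auto
  qed
  then show ?thesis by (auto simp: oarc_def)
qed

lemma oarc_supp: "oarc e \<inter> supp X = {}" if "e \<in> E" "X \<subseteq> E" "e \<notin> X"
proof -
  have "supp X \<inter> path_image (\<gamma> e) \<subseteq> p ` inc e"
    by (rule supp_Int[OF that(2,1,3)]) blast
  also have "\<dots> \<subseteq> p ` V"
    using inc_eq bl_in wh_in that(1) by auto
  finally show ?thesis
    using oarc_V[OF that(1)] oarc_sub[of e] by blast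
qed

lemma vertex_supp: "p v \<in> supp X \<longleftrightarrow> (\<exists>e\<in>X. e \<in> star v)" if X: "X \<subseteq> E" and v: "v \<in> V"
proof -
  have "p v \<in> path_image (\<gamma> e) \<longleftrightarrow> e \<in> star v" if "e \<in> X" for e
  proof -
    have e: "e \<in> E" using X that by blast
    have "p v \<in> path_image (\<gamma> e) \<longleftrightarrow> p v \<in> p ` inc e"
      using image_V[OF e] v by blast
    also have "\<dots> \<longleftrightarrow> v \<in> inc e"
      using inj_p v inc_eq[OF e] bl_in[OF e] wh_in[OF e] by (auto simp: inj_on_def)
    finally show ?thesis using e by (simp add: star_def)
  qed
  then show ?thesis by (auto simp: supp_def)
qed

lemma two_col_sub: "two_col c a b \<subseteq> E"
  by (auto simp: two_col_def)

lemma chain_E: "C \<subseteq> E" if "chain c a b C"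
  using chain_subset[OF that] two_col_sub by blast

lemma two_col_commute: "two_col c b a = two_col c a b"
  by (auto simp: two_col_def)

lemma adj_commute: "adj c b a = adj c a b"
  by (simp add: adj_def two_col_commute[of c b a])

lemma chain_commute: "chain c b a C = chain c a b C"
  by (simp add: chain_iff two_col_commute[of c b a] adj_commute[of c b a])

context
  fixes c :: "'e \<Rightarrow> nat" and a b :: nat
  assumes c: "col c" "a \<in> {1..3}" "b \<in> {1..3}" "a \<noteq> b"
begin

lemma ed_two_col: "ed c v a \<in> two_col c a b" "ed c v b \<in> two_col c a b" if "v \<in> V"
  using ed_star[OF c(1) that] col_ed[OF c(1) that] c(2,3) by (simp_all add: two_col_def star_def)

lemma chain_at: "chain c a b (chain_at c a b v)" "ed c v a \<in> chain_at c a b v" "ed c v b \<in> chain_at c a b v"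
  if v: "v \<in> V"
proof -
  show C: "chain c a b (chain_at c a b v)"
    unfolding chain_iff chain_at_def using ed_two_col(1)[OF v] by blast
  show a: "ed c v a \<in> chain_at c a b v" by (simp add: chain_at_def)
  show "ed c v b \<in> chain_at c a b v"
    using saturated_star[OF chain_saturated[OF C] ed_star[OF c(1) v c(2)] ed_star[OF c(1) v c(3)] ed_two_col[OF v]] a
    by simp
qed

lemma chain_at_eq: "chain_at c a b v = C" if "chain c a b C" "e \<in> C" "v \<in> inc e"
proof -
  have e: "e \<in> E" "e \<in> two_col c a b" "c e = a \<or> c e = b"
    using chain_subset[OF that(1)] that(2) by (auto simp: two_col_def)
  have v: "v \<in> V" using e that(3) inc_eq bl_in wh_in by auto
  have "e \<in> star v" using e that(3) by (simp add: star_def)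
  then have "e = ed c v a \<or> e = ed c v b"
    using ed_eq[OF c(1) v] e(3) by metis
  then show ?thesis
    using chain_unique[OF chain_at(1)[OF v] that(1)] chain_at(2,3)[OF v] that(2) by metis
qed

lemma chain_at_star: "chain_at c a b v \<inter> star v = {ed c v a, ed c v b}" if v: "v \<in> V"
proof -
  have "e = ed c v a \<or> e = ed c v b" if "e \<in> chain_at c a b v" "e \<in> star v" for e
    using chain_subset[OF chain_at(1)[OF v]] that ed_eq[OF c(1) v] by (auto simp: two_col_def)
  then show ?thesis
    using chain_at(2,3)[OF v] ed_star[OF c(1) v c(2)] ed_star[OF c(1) v c(3)] by auto
qed

end

context
  fixes c :: "'e \<Rightarrow> nat" and a b :: nat
  assumes c: "col c" "a \<in> {1..3}" "b \<in> {1..3}" "a \<noteq> b"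
begin

lemma chain_at_commute: "chain_at c b a v = chain_at c a b v" if v: "v \<in> V"
proof -
  have "chain c a b (chain_at c b a v)"
    using chain_at(1)[OF c(1,3,2) c(4)[symmetric] v] by (simp add: chain_commute[of c b a])
  moreover have "ed c v b \<in> chain_at c b a v" by (simp add: chain_at_def)
  ultimately show ?thesis
    using chain_unique[OF _ chain_at(1)[OF c v]] chain_at(3)[OF c v] by metis
qed

lemma wsum_commute: "wsum c b C z = - wsum c a C z" if "chain c a b C"
proof -
  have "(if c e = b then 1 else - 1) * w = - ((if c e = a then 1 else - 1) * w)" if "e \<in> C" for e and w :: complex
    using chain_subset[OF \<open>chain c a b C\<close>] that c(4) by (auto simp: two_col_def)
  then show ?thesis
    unfolding wsum_def sum_negf[symmetric] by (intro sum.cong) auto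
qed

lemma supp_ne: "supp C \<noteq> {}" if "chain c a b C"
  using chain_ne[OF that] by (auto simp: supp_def path_image_nonempty)

text \<open>Exchanging the colours reverses the direction of the curve, and uniqueness of the
  orientation carries this over to the chosen value.\<close>

lemma loop_sign_commute: "loop_sign c b C = - loop_sign c a C" if C: "chain c a b C"
proof (rule jordan_fun_unique[OF _ _ supp_ne[OF C]])
  show "jordan_fun (supp C) (wsum c b C) (loop_sign c b C)"
    by (rule loop_sign[OF c(1,3,2)]) (use c C in \<open>auto simp: chain_commute\<close>)
  show "jordan_fun (supp C) (wsum c b C) (- loop_sign c a C)"
    by (rule jordan_fun_cong[OF jordan_fun_minus[OF loop_sign[OF c C]]]) (simp add: wsum_commute[OF C])
qed

lemma third: "6 - a - b \<in> {1..3}" "6 - a - b \<noteq> a" "6 - a - b \<noteq> b"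
proof -
  have "(a = 1 \<or> a = 2 \<or> a = 3) \<and> (b = 1 \<or> b = 2 \<or> b = 3)" using c(2,3) by auto
  then show "6 - a - b \<in> {1..3}" "6 - a - b \<noteq> a" "6 - a - b \<noteq> b"
    using c(4) by auto
qed

lemma mid_third: "mid (ed c v (6 - a - b)) \<notin> supp C" if "v \<in> V" "chain c a b C"
proof -
  let ?e = "ed c v (6 - a - b)"
  have "?e \<in> E" "c ?e = 6 - a - b"
    using ed_star[OF c(1) that(1) third(1)] col_ed[OF c(1) that(1) third(1)] by (auto simp: star_def)
  then have "?e \<notin> C" using chain_subset[OF that(2)] third by (auto simp: two_col_def)
  then show ?thesis
    using oarc_supp[OF \<open>?e \<in> E\<close> chain_E[OF that(2)]] mid_oarc by blast
qed

text \<open>The edge of the third colour avoids the chain. So the winding number at its midpoint is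
  0 or the orientation \<open>\<omega>\<close>, and the sign is \<open>- \<omega>\<close> outside
  and \<open>\<omega>\<close> inside.\<close>

lemma S_pm: "S c a b v = 1 \<or> S c a b v = - 1" if v: "v \<in> V"
  using jordan_fun_cases[OF loop_sign[OF c chain_at(1)[OF c v]] mid_third[OF v chain_at(1)[OF c v]]]
    jordan_fun_omega[OF loop_sign[OF c chain_at(1)[OF c v]]] unfolding S_def by (elim disjE) simp_all

lemma S_anti: "S c b a v = - S c a b v" if v: "v \<in> V"
  unfolding S_def chain_at_commute[OF v] wsum_commute[OF chain_at(1)[OF c v]] loop_sign_commute[OF chain_at(1)[OF c v]]
  by (simp add: diff_diff_add add.commute)

end

section \<open>Comparing three chains at a vertex\<close>

lemma third_colour:
  assumes "i \<in> {1..3::nat}" "j \<in> {1..3}" "k \<in> {1..3}" "i \<noteq> j" "i \<noteq> k" "j \<noteq> k"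
  shows "6 - i - j = k"
proof -
  have "(i = 1 \<or> i = 2 \<or> i = 3) \<and> (j = 1 \<or> j = 2 \<or> j = 3) \<and> (k = 1 \<or> k = 2 \<or> k = 3)"
    using assms(1-3) by auto
  then show ?thesis using assms(4-) by auto
qed

text \<open>This isolates the two arcs ending at \<open>v\<close>, the only terms that can be
  discontinuous near \<open>p v\<close>. They enter with opposite signs.\<close>

lemma wsum_split:
  assumes c: "col c" "a \<in> {1..3}" "b \<in> {1..3}" "a \<noteq> b" and v: "v \<in> V"
  shows "wsum c a (chain_at c a b v) q =
    winding_number (\<gamma> (ed c v a)) q - winding_number (\<gamma> (ed c v b)) q + wsum c a (chain_at c a b v - star v) q"
proof -
  let ?C = "chain_at c a b v"
  have "finite ?C" using chain_E[OF chain_at(1)[OF c v]] finite_E by (rule finite_subset)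
  then have "wsum c a ?C q = wsum c a (?C \<inter> star v) q + wsum c a (?C - star v) q"
    unfolding wsum_def by (rule sum.Int_Diff)
  moreover have "ed c v a \<noteq> ed c v b"
    using col_ed[OF c(1) v c(2)] col_ed[OF c(1) v c(3)] c(4) by metis
  ultimately show ?thesis
    using col_ed[OF c(1) v c(2)] col_ed[OF c(1) v c(3)] c(4)
    by (simp add: chain_at_star[OF c v] wsum_def)
qed

lemma supp_mono: "X \<subseteq> Y \<Longrightarrow> supp X \<subseteq> supp Y"
  by (auto simp: supp_def)

lemma closed_supp: "closed (supp X)" if "X \<subseteq> E"
proof -
  have "finite X" using that finite_E by (rule finite_subset)
  then show ?thesis
    unfolding supp_def using that path_g by (intro closed_UN) (auto intro: closed_path_image)
qed

text \<open>Each edge lies on some chain, whose curve has empty interior.\<close>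

lemma interior_supp: "interior (supp E) = {}" if c: "col c"
  unfolding supp_def
proof (rule interior_UN_closed[OF finite_E])
  fix e assume e: "e \<in> E"
  show "closed (path_image (\<gamma> e))" by (rule closed_path_image[OF path_g[OF e]])
  obtain b where b: "b \<in> {1..3}" "c e \<noteq> b"
    using that[of 1] that[of 2] by (cases "c e = 1") auto
  have "e \<in> two_col c (c e) b" using e by (simp add: two_col_def)
  then obtain C where C: "chain c (c e) b C" "e \<in> C" using chain_ex by blast
  have "path_image (\<gamma> e) \<subseteq> supp C" using C(2) by (auto simp: supp_def)
  then show "interior (path_image (\<gamma> e)) = {}"
    using jordan_fun_interior[OF loop_sign[OF c col_range[OF e c] b C(1)]] interior_mono by blast
qed

lemma continuous_on_wsum: "continuous_on B (wsum c a X)" if "X \<subseteq> E" "B \<inter> supp X = {}"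
  unfolding wsum_def
proof (intro continuous_intros)
  fix e assume e: "e \<in> X"
  show "continuous_on B (winding_number (\<gamma> e))"
  proof (rule continuous_at_imp_continuous_on, rule ballI)
    fix z assume "z \<in> B"
    then have "z \<notin> path_image (\<gamma> e)" using that e by (auto simp: supp_def)
    then show "isCont (winding_number (\<gamma> e)) z"
      using continuous_at_winding_number path_g e that(1) by blast
  qed
qed

text \<open>The chains use the pairs \<open>(x, y)\<close>, \<open>(y, z)\<close> and
  \<open>(z, x)\<close>, each counting its first edge positively and its second negatively. In the
  sum of their winding numbers the arcs at \<open>v\<close> cancel, and the remainder
  \<open>H\<close> is continuous near \<open>p v\<close>. Elsewhere the chains may cross freely, so
  the second one may belong to another colouring.\<close>

lemma S_cyc:
  assumes c: "col c" and d: "col d" and st: "x \<in> star v" "y \<in> star v" "z \<in> star v"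
    and ne: "x \<noteq> y" "y \<noteq> z" "x \<noteq> z"
  shows "S c (c x) (c y) v = S d (d y) (d z) v"
proof -
  have v: "v \<in> V" using star_V[OF st(1)] .
  have E: "x \<in> E" "y \<in> E" "z \<in> E" using st star_E by blast+
  have rg: "f x \<in> {1..3}" "f y \<in> {1..3}" "f z \<in> {1..3}" if "col f" for f
    using col_range E that by blast+
  have neq: "f x \<noteq> f y" "f y \<noteq> f z" "f z \<noteq> f x" if "col f" for f
    using star_inj[OF that v] st ne by metis+
  have ed: "ed f v (f x) = x" "ed f v (f y) = y" "ed f v (f z) = z" if "col f" for f
    using ed_eq[OF that v] st by blast+
  let ?C1 = "chain_at c (c x) (c y) v" and ?C2 = "chain_at d (d y) (d z) v" and ?C3 = "chain_at c (c z) (c x) v"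
  note a1 = c rg(1,2)[OF c] neq(1)[OF c]
  note a2 = d rg(2,3)[OF d] neq(2)[OF d]
  note a3 = c rg(3,1)[OF c] neq(3)[OF c]
  note J1 = loop_sign[OF a1 chain_at(1)[OF a1 v]] and J2 = loop_sign[OF a2 chain_at(1)[OF a2 v]]
    and J3 = loop_sign[OF a3 chain_at(1)[OF a3 v]]
  have CE: "?C1 \<subseteq> E" "?C2 \<subseteq> E" "?C3 \<subseteq> E"
    using chain_E[OF chain_at(1)[OF a1 v]] chain_E[OF chain_at(1)[OF a2 v]] chain_E[OF chain_at(1)[OF a3 v]]
    by auto
  have Cst: "?C1 \<inter> star v = {x, y}" "?C2 \<inter> star v = {y, z}" "?C3 \<inter> star v = {z, x}"
    using chain_at_star[OF a1 v] chain_at_star[OF a2 v] chain_at_star[OF a3 v] ed[OF c] ed[OF d] by simp_all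
  \<comment> \<open>The edges not ending at \<open>v\<close> stay away from a small disc around
    \<open>p v\<close>.\<close>
  let ?N = "E - star v"
  have "p v \<notin> supp ?N" using vertex_supp[of ?N v] v by blast
  then have "p v \<in> - supp ?N" "open (- supp ?N)"
    using closed_supp[of ?N] by (auto simp: open_Compl)
  then obtain r where r: "r > 0" "ball (p v) r \<subseteq> - supp ?N"
    by (meson open_contains_ball)
  define H where "H q = wsum c (c x) (?C1 - star v) q + wsum d (d y) (?C2 - star v) q + wsum c (c z) (?C3 - star v) q" for q
  have cont: "continuous_on (ball (p v) r) (wsum f a (C - star v))" if "C \<subseteq> E" for f a C
  proof (rule continuous_on_wsum)
    have "supp (C - star v) \<subseteq> supp ?N" using that by (intro supp_mono) blast
    then show "ball (p v) r \<inter> supp (C - star v) = {}" using r(2) by blast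
  qed (use that in blast)
  have H: "continuous_on (ball (p v) r) H"
    unfolding H_def by (intro continuous_on_add cont CE)
  have sum: "wsum c (c x) ?C1 q + wsum d (d y) ?C2 q + wsum c (c z) ?C3 q = H q" for q
    using wsum_split[OF a1 v, of q] wsum_split[OF a2 v, of q] wsum_split[OF a3 v, of q] ed[OF c] ed[OF d]
    by (simp add: H_def)
  have sub: "supp ?C1 \<union> supp ?C2 \<union> supp ?C3 \<subseteq> supp E"
    using supp_mono CE by blast
  have osub: "oarc e \<subseteq> supp X" if "e \<in> X" for e X
    using oarc_sub[of e] that by (auto simp: supp_def)
  have cl: "p v \<in> closure (oarc x)" "p v \<in> closure (oarc y)" "p v \<in> closure (oarc z)"
    using closure_oarc E st by (auto simp: star_def)
  have mem: "x \<in> ?C1" "y \<in> ?C1" "y \<in> ?C2" "z \<in> ?C2" "z \<in> ?C3" "x \<in> ?C3"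
    using Cst by blast+
  have "z \<notin> ?C1 \<inter> star v" "x \<notin> ?C2 \<inter> star v" "y \<notin> ?C3 \<inter> star v"
    unfolding Cst using ne by auto
  then have nmem: "z \<notin> ?C1" "x \<notin> ?C2" "y \<notin> ?C3" using st by blast+
  have X: "oarc x \<subseteq> supp ?C1 \<inter> supp ?C3" "oarc x \<inter> supp ?C2 = {}"
    using osub[OF mem(1)] osub[OF mem(6)] oarc_supp[OF E(1) CE(2) nmem(2)] by blast+
  have Y: "oarc y \<subseteq> supp ?C1 \<inter> supp ?C2" "oarc y \<inter> supp ?C3 = {}"
    using osub[OF mem(2)] osub[OF mem(3)] oarc_supp[OF E(2) CE(3) nmem(3)] by blast+
  have Z: "oarc z \<subseteq> supp ?C2 \<inter> supp ?C3" "oarc z \<inter> supp ?C1 = {}"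
    using osub[OF mem(4)] osub[OF mem(5)] oarc_supp[OF E(3) CE(1) nmem(1)] by blast+
  have "2 * wsum c (c x) ?C1 (mid z) - loop_sign c (c x) ?C1 = 2 * wsum d (d y) ?C2 (mid x) - loop_sign d (d y) ?C2"
    by (rule three_jordan_funs(1)[OF J1 J2 J3 closed_supp[OF subset_refl] interior_supp[OF c] sub r(1) H sum
          connected_oarc[OF E(1)] X cl(1) mid_oarc connected_oarc[OF E(2)] Y cl(2) mid_oarc
          connected_oarc[OF E(3)] Z cl(3) mid_oarc])
  moreover have "ed c v (6 - c x - c y) = z" "ed d v (6 - d y - d z) = x"
    using third_colour[OF rg[OF c] neq(1)[OF c] neq(3)[OF c, symmetric] neq(2)[OF c]]
      third_colour[OF rg(2,3,1)[OF d] neq(2)[OF d] neq(1)[OF d, symmetric] neq(3)[OF d]] ed(3)[OF c] ed(1)[OF d]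
    by simp_all
  ultimately show ?thesis
    by (simp add: S_def)
qed

section \<open>Parity of the number of enclosing chains\<close>

text \<open>Distinct arcs meet only in common vertices, and chains through a common vertex
  coincide.\<close>

lemma chain_supp_disjoint: "supp C \<inter> supp D = {}" if C: "chain c a b C" and D: "chain c a b D" and "C \<noteq> D"
proof (rule ccontr)
  assume "\<not> ?thesis"
  then obtain z e f where z: "e \<in> C" "f \<in> D" "z \<in> path_image (\<gamma> e) \<inter> path_image (\<gamma> f)"
    by (auto simp: supp_def)
  have E: "e \<in> E" "f \<in> E" using chain_E C D z by blast+
  have "e \<noteq> f" using chain_unique[OF C D] z \<open>C \<noteq> D\<close> by blast
  then have "inc e \<inter> inc f \<noteq> {}" using cross[OF E] z(3) by blast
  then have "f \<in> C"
    using chain_saturated[OF C] subsetD[OF chain_subset[OF D] z(2)] z(1) unfolding saturated_def by blast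
  then show False using chain_unique[OF C D] z \<open>C \<noteq> D\<close> by blast
qed

text \<open>\<open>t\<close> is the parity of the number of chains enclosing the midpoint of an
  edge. A chain other than \<open>C\<close> meets neither \<open>C\<close> nor the open arcs of the
  \<open>k\<close>-edges attached to it, so it encloses all of them or none. What varies is whether
  \<open>C\<close> itself encloses the edge, and this also determines the sign.\<close>

lemma S_bal:
  assumes c: "col c" "a \<in> {1..3}" "b \<in> {1..3}" and k: "k \<in> {1..3}" and ab: "a \<noteq> b" and ne: "a \<noteq> k" "b \<noteq> k"
  shows "\<exists>t. (\<forall>e. t e = 1 \<or> t e = - 1) \<and> (\<forall>C. chain c a b C \<longrightarrow>
            (\<exists>\<kappa>. \<forall>e\<in>C. \<forall>v\<in>inc e. S c a b v = \<kappa> * t (ed c v k)))"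
proof -
  note c' = c ab
  define around where "around q = {D. chain c a b D \<and> wsum c a D q \<noteq> 0}" for q
  define t where "t e = (- 1 :: complex) ^ card (around (mid e))" for e
  have fin: "finite (around q)" for q
    unfolding around_def by (rule finite_subset[OF _ finite_chains[of c a b]]) blast
  have k': "6 - a - b = k" using third_colour[of a b k] c k ab ne by simp
  have "\<exists>\<kappa>. \<forall>e\<in>C. \<forall>v\<in>inc e. S c a b v = \<kappa> * t (ed c v k)" if C: "chain c a b C" for C
  proof -
    obtain e0 where e0: "e0 \<in> C" using chain_ne[OF C] by blast
    \<comment> \<open>A reference point on \<open>C\<close>, independent of \<open>v\<close>, at
      which the other chains are counted.\<close>
    define q0 where "q0 = p (bl e0)"
    have pC: "p v \<in> supp C" if "e \<in> C" "v \<in> inc e" for e v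
    proof -
      have e: "e \<in> E" using chain_E[OF C] that by blast
      have "v \<in> V" using inc_eq[OF e] bl_in[OF e] wh_in[OF e] that by auto
      then show ?thesis using vertex_supp[OF chain_E[OF C]] that e by (auto simp: star_def)
    qed
    have q0: "q0 \<in> supp C"
      unfolding q0_def using pC[OF e0] inc_eq chain_E[OF C] e0 by blast
    let ?n = "card (around q0 - {C})"
    \<comment> \<open>The factor is the sign for a \<open>k\<close>-edge outside \<open>C\<close>
      times the parity of the other chains; for an edge inside, both \<open>S\<close> and
      \<open>t\<close> change sign.\<close>
    have "S c a b v = (- loop_sign c a C * (- 1) ^ ?n) * t (ed c v k)" if e: "e \<in> C" "v \<in> inc e" for e v
    proof -
      let ?g = "ed c v k"
      have eE: "e \<in> E" using chain_E[OF C] e by blast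
      have v: "v \<in> V" using inc_eq[OF eE] bl_in[OF eE] wh_in[OF eE] e by auto
      have g: "?g \<in> E" "v \<in> inc ?g" "c ?g = k"
        using ed_star[OF c(1) v k] col_ed[OF c(1) v k] by (auto simp: star_def)
      have gD: "?g \<notin> D" if "chain c a b D" for D
        using chain_subset[OF that] g(3) ne by (auto simp: two_col_def)
      have same: "wsum c a D (mid ?g) = wsum c a D q0" if D: "chain c a b D" "D \<noteq> C" for D
      proof -
        note J = loop_sign[OF c' D(1)]
        have disj: "supp C \<inter> supp D = {}" using chain_supp_disjoint[OF C D(1)] D(2) by blast
        have "wsum c a D (mid ?g) = wsum c a D (p v)"
        proof (rule jordan_fun_const[OF J])
          show "connected (insert (p v) (oarc ?g))"
            by (rule connected_intermediate_closure[OF connected_oarc[OF g(1)]])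
              (use closure_oarc[OF g(1,2)] closure_subset in auto)
          show "insert (p v) (oarc ?g) \<inter> supp D = {}"
            using pC[OF e] disj oarc_supp[OF g(1) chain_E[OF D(1)] gD[OF D(1)]] by blast
        qed (use mid_oarc in auto)
        also have "\<dots> = wsum c a D q0"
          by (rule jordan_fun_const[OF J _ disj]) (use chain_jordan[OF c' C] pC[OF e] q0 in auto)
        finally show ?thesis .
      qed
      let ?W = "wsum c a C (mid ?g)"
      have "D \<in> around (mid ?g) - {C} \<longleftrightarrow> D \<in> around q0 - {C}" for D
        unfolding around_def Diff_iff mem_Collect_eq singleton_iff using same[of D] by metis
      then have "around (mid ?g) - {C} = around q0 - {C}" by blast
      moreover have "C \<in> around (mid ?g) \<longleftrightarrow> ?W \<noteq> 0"
        using C by (simp add: around_def)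
      ultimately have card: "card (around (mid ?g)) = (if ?W = 0 then ?n else Suc ?n)"
        using fin[of "mid ?g"] by (metis Diff_empty Diff_insert0 card.remove)
      have "?W = 0 \<or> ?W = loop_sign c a C"
        by (rule jordan_fun_cases[OF loop_sign[OF c' C] mid_third[OF c' v C, unfolded k']])
      moreover have "loop_sign c a C = 1 \<or> loop_sign c a C = - 1"
        using jordan_fun_omega[OF loop_sign[OF c' C]] .
      moreover have "((- 1) ^ ?n) * (- 1) ^ ?n = (1 :: complex)"
        by (simp add: power_mult_distrib[symmetric])
      moreover have "S c a b v = 2 * ?W - loop_sign c a C"
        unfolding S_def k' chain_at_eq[OF c' C e] ..
      ultimately show ?thesis
        unfolding t_def card by (elim disjE) (simp_all add: mult.assoc)
    qed
    then have "\<forall>e\<in>C. \<forall>v\<in>inc e. S c a b v = (- loop_sign c a C * (- 1) ^ ?n) * t (ed c v k)"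
      by (intro ballI)
    then show ?thesis by (rule exI)
  qed
  moreover have "t e = 1 \<or> t e = - 1" for e
    unfolding t_def by (cases "even (card (around (mid e)))") simp_all
  ultimately show ?thesis by (intro exI[of _ t] conjI allI impI)
qed

sublocale kempe_sign V E inc bl wh S
proof unfold_locales
  show "S c a b v = 1 \<or> S c a b v = - 1"
    if "col c" "v \<in> V" "a \<in> {1..3}" "b \<in> {1..3}" "a \<noteq> b" for c a b v
    by (rule S_pm[OF that(1,3-5,2)])
  show "S c b a v = - S c a b v"
    if "col c" "v \<in> V" "a \<in> {1..3}" "b \<in> {1..3}" "a \<noteq> b" for c a b v
    by (rule S_anti[OF that(1,3-5,2)])
qed (fact S_cyc S_bal conn)+

end

theorem theorem14:
  fixes V :: "'v set" and E :: "'e set" and inc :: "'e \<Rightarrow> 'v set"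
  assumes "multigraph V E inc"
    and "cubic V E inc"
    and "k_connected 2 V E inc"
    and "\<not> k_connected 3 V E inc"
    and "planar V E inc"
    and "bipartite V E inc"
  shows "num_kempe_classes E inc 3 = 1"
proof -
  obtain A where A: "A \<subseteq> V" "\<And>e. e \<in> E \<Longrightarrow> card (inc e \<inter> A) = 1"
    using assms(6) by (auto simp: bipartite_def)
  have mg: "finite V" "finite E" "\<And>e. e \<in> E \<Longrightarrow> inc e \<subseteq> V" "\<And>e. e \<in> E \<Longrightarrow> card (inc e) = 2"
    using assms(1) by (auto simp: multigraph_def)
  have "\<forall>e\<in>E. \<exists>u w. inc e = {u, w} \<and> u \<in> A \<and> w \<notin> A"
  proof
    fix e assume e: "e \<in> E"
    obtain x y where xy: "inc e = {x, y}" "x \<noteq> y"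
      using mg(4)[OF e] by (meson card_2_iff)
    have "card ({x, y} \<inter> A) = 1" using A(2)[OF e] xy by simp
    then have "(x \<in> A \<and> y \<notin> A) \<or> (y \<in> A \<and> x \<notin> A)"
      using xy(2) by (cases "x \<in> A"; cases "y \<in> A") auto
    then show "\<exists>u w. inc e = {u, w} \<and> u \<in> A \<and> w \<notin> A"
      using xy(1) by (metis insert_commute)
  qed
  then obtain bl wh where bw: "\<And>e. e \<in> E \<Longrightarrow> inc e = {bl e, wh e} \<and> bl e \<in> A \<and> wh e \<notin> A"
    by metis
  have ends: "bl e \<in> V" "wh e \<in> V" if "e \<in> E" for e
    using bw[OF that] mg(3)[OF that] by auto
  obtain p :: "'v \<Rightarrow> complex" and \<gamma> :: "'e \<Rightarrow> real \<Rightarrow> complex" where plane: "inj_on p V \<and>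
      (\<forall>e\<in>E. arc (\<gamma> e) \<and> {pathstart (\<gamma> e), pathfinish (\<gamma> e)} = p ` inc e \<and>
        path_image (\<gamma> e) \<inter> p ` V = p ` inc e) \<and>
      (\<forall>e\<in>E. \<forall>f\<in>E. e \<noteq> f \<longrightarrow> path_image (\<gamma> e) \<inter> path_image (\<gamma> f) \<subseteq> p ` (inc e \<inter> inc f))"
    using assms(5) unfolding planar_def by (elim exE) (rule that)
  have p: "inj_on p V" using plane by (rule conjunct1)
  have g: "arc (\<gamma> e) \<and> {pathstart (\<gamma> e), pathfinish (\<gamma> e)} = p ` inc e \<and>
      path_image (\<gamma> e) \<inter> p ` V = p ` inc e" if "e \<in> E" for e
    using bspec[OF conjunct1[OF conjunct2[OF plane]] that] .
  have cr: "path_image (\<gamma> e) \<inter> path_image (\<gamma> f) \<subseteq> p ` (inc e \<inter> inc f)"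
    if "e \<in> E" "f \<in> E" "e \<noteq> f" for e f
    using bspec[OF bspec[OF conjunct2[OF conjunct2[OF plane]] that(1)] that(2)] that(3) by (rule mp)
  \<comment> \<open>Arcs are reversed where necessary so that all of them run from black to
    white.\<close>
  define \<delta> where "\<delta> e = (if pathstart (\<gamma> e) = p (bl e) then \<gamma> e else reversepath (\<gamma> e))" for e
  have \<delta>: "path_image (\<delta> e) = path_image (\<gamma> e)" for e
    by (simp add: \<delta>_def)
  \<comment> \<open>2-connectedness applied to the empty set of deleted vertices.\<close>
  have conn: "connected_on E inc (V - {})"
    using assms(3) unfolding k_connected_def by (metis card.empty empty_subsetI zero_less_numeral)
  interpret plane_bip_cubic V E inc bl wh p \<delta>
  proof unfold_locales
    fix e assume e: "e \<in> E"
    have pe: "{pathstart (\<gamma> e), pathfinish (\<gamma> e)} = {p (bl e), p (wh e)}"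
      using g[OF e] bw[OF e] by simp
    then show "pathstart (\<delta> e) = p (bl e)" "pathfinish (\<delta> e) = p (wh e)"
      by (auto simp: \<delta>_def doubleton_eq_iff)
    show "arc (\<delta> e)" using g[OF e] by (simp add: \<delta>_def arc_reversepath)
    show "path_image (\<delta> e) \<inter> p ` V = p ` inc e" using g[OF e] by (simp add: \<delta>)
    show "inc e = {bl e, wh e}" using bw[OF e] by blast
    show "bl e \<noteq> wh f" if "f \<in> E" for f using bw[OF e] bw[OF that] by metis
    show "path_image (\<delta> e) \<inter> path_image (\<delta> f) \<subseteq> p ` (inc e \<inter> inc f)" if "f \<in> E" "e \<noteq> f" for f
      using cr[OF e that] by (simp add: \<delta>)
  next
    show "card {e \<in> E. v \<in> inc e} = 3" if "v \<in> V" for v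
      using assms(2) that by (simp add: cubic_def degree_def)
    show "connected_on E inc V" using conn by simp
  qed (fact mg(1) mg(2) ends p)+
  obtain c where "col c" using colouring_exists by blast
  then show ?thesis
    by (rule num_kempe_classes_eq_1) (rule all_equiv)
qed

end
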